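(* Let $k\in\mathbb{N}$ and let $\mathsf{D}$ be a finite, coherent, interface-respecting DP-core with identity cleaning, equipped with a witness action. Then the Relabeled Inclusion Test (described in the context) terminates. Moreover, it returns "Inclusion Holds" if and only if every graph of treewidth at most $k$ belongs to $\mathcal{P}(\mathsf{D})$, and otherwise it returns a canonized $(k,\mathsf{D})$-refutation.
   Context: Graphs are triples $(V,E,\rho)$ with $V,E$ finite subsets of $\mathbb{N}$, $\rho\subseteq E\times V$, each edge incident to exactly two distinct vertices (parallel edges allowed); graph properties are isomorphism-closed sets of graphs. Instructive decompositions: the $k$-instructive alphabet has $\mathtt{Leaf}$ (arity 0), $\mathtt{IntroVertex}_u$, $\mathtt{ForgetVertex}_u$ ($u\in[k+1]$), $\mathtt{IntroEdge}_{u,v}$ (distinct $u,v$) of arity 1 and $\mathtt{Join}$ of arity 2; $\mathcal{T}_k$ is the set of terms legal w.r.t. bags (Leaf: $\emptyset$; IntroVertex$_u$ needs $u\notin$ bag, adds $u$; ForgetVertex$_u$ needs $u\in$ bag, removes $u$; IntroEdge$_{u,v}$ needs $u,v\in$ bag; Join needs equal child bags). $G(\tau)$ is the graph built: Leaf empty; IntroVertex$_u$ adds a fresh isolated vertex labeled $u$; ForgetVertex$_u$ removes label $u$; IntroEdge$_{u,v}$ adds an edge between the vertices labeled $u,v$; Join is the disjoint union of the children identifying vertices with the same bag label (edges never identified). A graph has treewidth $\le k$ iff it is isomorphic to some $G(\tau)$, $\tau\in\mathcal{T}_k$. DP-cores: $\mathsf{D}[k]$ consists of a decidable set $\mathcal{W}_k\subseteq\{0,1\}^*$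 of witnesses, $\mathtt{Final}_k:\mathcal{W}_k\to\{0,1\}$, a finite set $\mathtt{Leaf}_k$, transition functions $\mathtt{IntroVertex}_u,\mathtt{ForgetVertex}_u,\mathtt{IntroEdge}_{u,v}:\mathcal{W}_k\to$ finite subsets, $\mathtt{Join}:\mathcal{W}_k^2\to$ finite subsets (lifted to finite sets by union), and $\mathtt{Clean}_k$. The dynamization $\mathrm{Dyn}_k(\tau)$ is computed bottom-up ($\mathtt{Leaf}_k$ at leaves, then lifted transition followed by $\mathtt{Clean}_k$); $\mathsf{D}[k]$ accepts $\tau$ if $\mathrm{Dyn}_k(\tau)$ contains $w$ with $\mathtt{Final}_k(w)=1$ (final witness). $\mathcal{P}(\mathsf{D})=\bigcup_k$ iso-closure of accepted graphs. Finite: each $\mathcal{W}_k$ finite. Identity cleaning: $\mathtt{Clean}_k=\mathrm{id}$. Coherent: acceptance of $\tau\in\mathcal{T}_k$ and $\tau'\in\mathcal{T}_{k'}$ agree whenever $G(\tau)\cong G(\tau')$. Labels: each $w$ has $\mathrm{Lbl}_k(w)\subseteq[k+1]$; $\mathrm{Lbl}_k(S)=\bigcup_{w\in S}\mathrm{Lbl}_k(w)$. A state $(b,S)$ ($b\subseteq[k+1]$, $S\subseteq\mathcal{W}_k$ finite) is well-formed if $\mathrm{Lbl}_k(S)\subseteq b$; inconsistent if $S$ contains no final witness; initial state $(\emptyset,\mathtt{Leaf}_k)$. Interface-respecting: $\mathrm{Lbl}_k(\mathtt{Leaf}_k)=\emptyset$ and whenever $\mathrm{Lbl}_k(S),\mathrm{Lbl}_k(S')\subseteq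 b$: $\mathrm{Lbl}_k(\mathtt{IntroVertex}_u(S))\subseteq b\cup\{u\}$ ($u\notin b$), $\mathrm{Lbl}_k(\mathtt{ForgetVertex}_u(S))\subseteq b\setminus\{u\}$ ($u\in b$), $\mathrm{Lbl}_k(\mathtt{IntroEdge}_{u,v}(S))\subseteq b$ ($u,v\in b$), $\mathrm{Lbl}_k(\mathtt{Join}(S,S'))\subseteq b$, $\mathrm{Lbl}_k(\mathtt{Clean}_k(S))\subseteq b$. Relabelings and actions: $\mathcal{F}_k$ = injective maps $f:b\to[k+1]$, $b\subseteq[k+1]$; $f^{-1}$ inverse on image; $f\circ g$ partial composition. A witness action is a partial map $\rho(f,w)$ defined iff $\mathrm{Lbl}_k(w)\subseteq\mathrm{dom}(f)$, extended pointwise to sets, preserving finality, with $\mathrm{Lbl}_k(\rho(f,w))=f(\mathrm{Lbl}_k(w))$, $\rho(f^{-1},\rho(f,w))=w$, $\rho(f\circ f',w)=\rho(f,\rho(f',w))$, $\rho(f',w)=\rho(f,w)$ if $f'$ extends $f$, and commuting with transitions ($\rho(f,\mathtt{IntroVertex}_u(w))=\mathtt{IntroVertex}_{f(u)}(\rho(f,w))$, same for ForgetVertex, $\rho(f,\mathtt{IntroEdge}_{u,v}(w))=\mathtt{IntroEdge}_{f(u),f(v)}(\rho(f,w))$, $\rho(f,\mathtt{Join}(w,w'))=\mathtt{Join}(\rho(f,w),\rho(f,w'))$). Canonization: fix a total order on $\mathcal{W}_k$; order pairs $(b,S)$ lexicographically by (increasing enumeration of $b$, increasing enumeration of $S$),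 with proper prefixes smaller. For well-formed $(b,S)$, $\mathrm{CAN}(b,S)=\min\{(f(b),\rho(f,S)):f\in\mathcal{F}_k,\mathrm{dom}(f)=b\}$; $(b,S)$ is canonical if it equals $\mathrm{CAN}(b,S)$. A canonized $(k,\mathsf{D})$-refutation is a sequence of canonical well-formed states $(b_0,S_0),\dots,(b_m,S_m)$ with the first initial, the last inconsistent, and each $(b_i,S_i)$, $i\ge1$, obtained for some injective $f_i$ and some $j<i$ as $(f_i(b_j\cup\{u\}),\rho(f_i,\mathtt{IntroVertex}_u(S_j)))$ ($u\notin b_j$), $(f_i(b_j\setminus\{u\}),\rho(f_i,\mathtt{ForgetVertex}_u(S_j)))$ ($u\in b_j$), $(f_i(b_j),\rho(f_i,\mathtt{IntroEdge}_{u,v}(S_j)))$ ($u\ne v\in b_j$), or $(f_i(b_j),\rho(f_i,\mathtt{Join}(S_j,\rho(\pi,S_l))))$ ($l<i$, $b_l=b_j$, $\pi$ a permutation of $b_j$), with $\mathrm{dom}(f_i)$ the bag to which it is applied. Relabeled Inclusion Test: initialize an empty list $R$, $Init=\mathrm{CAN}(\emptyset,\mathtt{Leaf}_k)$, a FIFO queue $Y=[Init]$ and $Seen=\{Init\}$. While $Y$ is nonempty: remove the next pair $(b,S)$ from $Y$ and append it to $R$; if it is inconsistent, return $R$; otherwise generate the successors $(b\cup\{u\},\mathtt{IntroVertex}_u(S))$ for $u\in[k+1]\setminus b$, $(b\setminus\{u\},\mathtt{ForgetVertex}_u(S))$ for $u\in b$, $(b,\mathtt{IntroEdge}_{u,v}(S))$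 for distinct $u,v\in b$, and, for every $(b',S')\in R$ with $b'=b$ and every permutation $\pi$ of $b$, both $(b,\mathtt{Join}(S,\rho(\pi,S')))$ and $(b,\mathtt{Join}(S',\rho(\pi,S)))$; each successor $X$ is replaced by $\mathrm{CAN}(X)$, and if not in $Seen$ it is added to $Seen$ and appended to $Y$. When $Y$ is empty, return "Inclusion Holds". *)

theory Defs
  imports Main "HOL-Library.While_Combinator"
begin

definition map_inverse :: "('a \<rightharpoonup> 'b) \<Rightarrow> ('b \<rightharpoonup> 'a)" where
  "map_inverse f = (\<lambda>y. if y \<in> ran f then Some (THE x. f x = Some y) else None)"

definition map_image :: "('a \<rightharpoonup> 'b) \<Rightarrow> 'a set \<Rightarrow> 'b set" where
  "map_image f A = {y. \<exists>x\<in>A. f x = Some y}"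

record mgraph =
  verts :: "nat set"
  edges :: "nat set"
  inc :: "(nat \<times> nat) set"

definition is_graph :: "mgraph \<Rightarrow> bool" where
  "is_graph G \<longleftrightarrow> finite (verts G) \<and> finite (edges G) \<and> inc G \<subseteq> edges G \<times> verts G \<and>
     (\<forall>e\<in>edges G. card {v. (e, v) \<in> inc G} = 2)"

definition graph_iso :: "mgraph \<Rightarrow> mgraph \<Rightarrow> bool" where
  "graph_iso G H \<longleftrightarrow> (\<exists>\<phi> \<psi>. bij_betw \<phi> (verts G) (verts H) \<and> bij_betw \<psi> (edges G) (edges H) \<and>
     (\<forall>e\<in>edges G. \<forall>v\<in>verts G. (e, v) \<in> inc G \<longleftrightarrow> (\<psi> e, \<phi> v) \<in> inc H))"

datatype itd =
    Leaf
  | IntroVertex nat itd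
  | ForgetVertex nat itd
  | IntroEdge nat nat itd
  | Join itd itd

abbreviation label_set :: "nat \<Rightarrow> nat set" where
  "label_set k \<equiv> {1..k+1}"

primrec bag :: "itd \<Rightarrow> nat set" where
  "bag Leaf = {}"
| "bag (IntroVertex u \<tau>) = insert u (bag \<tau>)"
| "bag (ForgetVertex u \<tau>) = bag \<tau> - {u}"
| "bag (IntroEdge u v \<tau>) = bag \<tau>"
| "bag (Join \<sigma> \<tau>) = bag \<sigma>"

primrec legal :: "nat \<Rightarrow> itd \<Rightarrow> bool" where
  "legal k Leaf \<longleftrightarrow> True"
| "legal k (IntroVertex u \<tau>) \<longleftrightarrow> legal k \<tau> \<and> u \<in> label_set k \<and> u \<notin> bag \<tau>"
| "legal k (ForgetVertex u \<tau>) \<longleftrightarrow> legal k \<tau> \<and> u \<in> label_set k \<and> u \<in> bag \<tau>"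
| "legal k (IntroEdge u v \<tau>) \<longleftrightarrow> legal k \<tau> \<and> u \<in> label_set k \<and> v \<in> label_set k \<and> u \<noteq> v \<and>
     u \<in> bag \<tau> \<and> v \<in> bag \<tau>"
| "legal k (Join \<sigma> \<tau>) \<longleftrightarrow> legal k \<sigma> \<and> legal k \<tau> \<and> bag \<sigma> = bag \<tau>"

definition fresh :: "nat set \<Rightarrow> nat" where
  "fresh A = (LEAST n. n \<notin> A)"

text \<open>The disjoint union is realised by sending the left graph to even numbers and the right graph
  to odd numbers, except that a right vertex carrying a bag label is sent to the image of the left
  vertex with that label. The second component maps each bag label to its vertex.\<close>

primrec build :: "itd \<Rightarrow> mgraph \<times> (nat \<rightharpoonup> nat)" where
  "build Leaf = (\<lparr>verts = {}, edges = {}, inc = {}\<rparr>, Map.empty)"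
| "build (IntroVertex u \<tau>) = (case build \<tau> of (G, \<theta>) \<Rightarrow>
     let x = fresh (verts G) in (G\<lparr>verts := insert x (verts G)\<rparr>, \<theta>(u \<mapsto> x)))"
| "build (ForgetVertex u \<tau>) = (case build \<tau> of (G, \<theta>) \<Rightarrow> (G, \<theta>(u := None)))"
| "build (IntroEdge u v \<tau>) = (case build \<tau> of (G, \<theta>) \<Rightarrow>
     let e = fresh (edges G) in
     (G\<lparr>edges := insert e (edges G),
        inc := {(e, the (\<theta> u)), (e, the (\<theta> v))} \<union> inc G\<rparr>, \<theta>))"
| "build (Join \<sigma> \<tau>) = (case build \<sigma> of (G, \<theta>) \<Rightarrow> case build \<tau> of (H, \<eta>) \<Rightarrow>
     let left = (\<lambda>x. 2 * x);
         right = (\<lambda>x. case (\<theta> \<circ>\<^sub>m map_inverse \<eta>) x of Some y \<Rightarrow> 2 * y | None \<Rightarrow> 2 * x + 1)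
     in (\<lparr>verts = left ` verts G \<union> right ` verts H,
          edges = (\<lambda>e. 2 * e) ` edges G \<union> (\<lambda>e. 2 * e + 1) ` edges H,
          inc = (\<lambda>(e, v). (2 * e, left v)) ` inc G \<union> (\<lambda>(e, v). (2 * e + 1, right v)) ` inc H\<rparr>,
         (\<lambda>u. map_option left (\<theta> u))))"

definition graph_of :: "itd \<Rightarrow> mgraph" where
  "graph_of \<tau> = fst (build \<tau>)"

definition treewidth_le :: "nat \<Rightarrow> mgraph \<Rightarrow> bool" where
  "treewidth_le k G \<longleftrightarrow> is_graph G \<and> (\<exists>\<tau>. legal k \<tau> \<and> graph_iso G (graph_of \<tau>))"

type_synonym witness = "bool list"

text \<open>The first argument of every component is the width parameter.\<close>

record dpcore =
  wits :: "nat \<Rightarrow> witness set"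
  final :: "nat \<Rightarrow> witness \<Rightarrow> bool"
  leafs :: "nat \<Rightarrow> witness set"
  intro_vertex :: "nat \<Rightarrow> nat \<Rightarrow> witness \<Rightarrow> witness set"
  forget_vertex :: "nat \<Rightarrow> nat \<Rightarrow> witness \<Rightarrow> witness set"
  intro_edge :: "nat \<Rightarrow> nat \<Rightarrow> nat \<Rightarrow> witness \<Rightarrow> witness set"
  joins :: "nat \<Rightarrow> witness \<Rightarrow> witness \<Rightarrow> witness set"
  clean :: "nat \<Rightarrow> witness set \<Rightarrow> witness set"

definition fin_subsets :: "'a set \<Rightarrow> 'a set set" where
  "fin_subsets A = {S. finite S \<and> S \<subseteq> A}"

definition is_dpcore :: "dpcore \<Rightarrow> bool" where
  "is_dpcore D \<longleftrightarrow> (\<forall>k.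
     leafs D k \<in> fin_subsets (wits D k) \<and>
     (\<forall>u\<in>label_set k. \<forall>w\<in>wits D k.
        intro_vertex D k u w \<in> fin_subsets (wits D k) \<and>
        forget_vertex D k u w \<in> fin_subsets (wits D k)) \<and>
     (\<forall>u\<in>label_set k. \<forall>v\<in>label_set k. u \<noteq> v \<longrightarrow>
        (\<forall>w\<in>wits D k. intro_edge D k u v w \<in> fin_subsets (wits D k))) \<and>
     (\<forall>w\<in>wits D k. \<forall>w'\<in>wits D k. joins D k w w' \<in> fin_subsets (wits D k)) \<and>
     (\<forall>S\<in>fin_subsets (wits D k). clean D k S \<in> fin_subsets (wits D k)))"

definition intro_vertex_set :: "dpcore \<Rightarrow> nat \<Rightarrow> nat \<Rightarrow> witness set \<Rightarrow> witness set" where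
  "intro_vertex_set D k u S = (\<Union>w\<in>S. intro_vertex D k u w)"

definition forget_vertex_set :: "dpcore \<Rightarrow> nat \<Rightarrow> nat \<Rightarrow> witness set \<Rightarrow> witness set" where
  "forget_vertex_set D k u S = (\<Union>w\<in>S. forget_vertex D k u w)"

definition intro_edge_set :: "dpcore \<Rightarrow> nat \<Rightarrow> nat \<Rightarrow> nat \<Rightarrow> witness set \<Rightarrow> witness set" where
  "intro_edge_set D k u v S = (\<Union>w\<in>S. intro_edge D k u v w)"

definition join_set :: "dpcore \<Rightarrow> nat \<Rightarrow> witness set \<Rightarrow> witness set \<Rightarrow> witness set" where
  "join_set D k S S' = (\<Union>w\<in>S. \<Union>w'\<in>S'. joins D k w w')"

primrec dyn :: "dpcore \<Rightarrow> nat \<Rightarrow> itd \<Rightarrow> witness set" where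
  "dyn D k Leaf = leafs D k"
| "dyn D k (IntroVertex u \<tau>) = clean D k (intro_vertex_set D k u (dyn D k \<tau>))"
| "dyn D k (ForgetVertex u \<tau>) = clean D k (forget_vertex_set D k u (dyn D k \<tau>))"
| "dyn D k (IntroEdge u v \<tau>) = clean D k (intro_edge_set D k u v (dyn D k \<tau>))"
| "dyn D k (Join \<sigma> \<tau>) = clean D k (join_set D k (dyn D k \<sigma>) (dyn D k \<tau>))"

definition accepts :: "dpcore \<Rightarrow> nat \<Rightarrow> itd \<Rightarrow> bool" where
  "accepts D k \<tau> \<longleftrightarrow> (\<exists>w\<in>dyn D k \<tau>. final D k w)"

definition graph_property :: "dpcore \<Rightarrow> mgraph set" where
  "graph_property D =
     (\<Union>k. {G. is_graph G \<and> (\<exists>\<tau>. legal k \<tau> \<and> accepts D k \<tau> \<and> graph_iso G (graph_of \<tau>))})"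

definition finite_core :: "dpcore \<Rightarrow> bool" where
  "finite_core D \<longleftrightarrow> (\<forall>k. finite (wits D k))"

definition identity_cleaning :: "dpcore \<Rightarrow> bool" where
  "identity_cleaning D \<longleftrightarrow> (\<forall>k. \<forall>S\<in>fin_subsets (wits D k). clean D k S = S)"

definition coherent :: "dpcore \<Rightarrow> bool" where
  "coherent D \<longleftrightarrow> (\<forall>k k' \<tau> \<tau>'. legal k \<tau> \<and> legal k' \<tau>' \<and> graph_iso (graph_of \<tau>) (graph_of \<tau>') \<longrightarrow>
     (accepts D k \<tau> \<longleftrightarrow> accepts D k' \<tau>'))"

type_synonym labelling = "nat \<Rightarrow> witness \<Rightarrow> nat set"
type_synonym state = "nat set \<times> witness set"

definition is_labelling :: "dpcore \<Rightarrow> labelling \<Rightarrow> bool" where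
  "is_labelling D Lbl \<longleftrightarrow> (\<forall>k. \<forall>w\<in>wits D k. Lbl k w \<subseteq> label_set k)"

definition Lbl_set :: "labelling \<Rightarrow> nat \<Rightarrow> witness set \<Rightarrow> nat set" where
  "Lbl_set Lbl k S = (\<Union>w\<in>S. Lbl k w)"

definition well_formed :: "dpcore \<Rightarrow> labelling \<Rightarrow> nat \<Rightarrow> state \<Rightarrow> bool" where
  "well_formed D Lbl k X \<longleftrightarrow> (case X of (b, S) \<Rightarrow>
     b \<subseteq> label_set k \<and> S \<in> fin_subsets (wits D k) \<and> Lbl_set Lbl k S \<subseteq> b)"

definition inconsistent :: "dpcore \<Rightarrow> nat \<Rightarrow> state \<Rightarrow> bool" where
  "inconsistent D k X \<longleftrightarrow> \<not> (\<exists>w\<in>snd X. final D k w)"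

definition initial_state :: "dpcore \<Rightarrow> nat \<Rightarrow> state" where
  "initial_state D k = ({}, leafs D k)"

definition interface_respecting :: "dpcore \<Rightarrow> labelling \<Rightarrow> bool" where
  "interface_respecting D Lbl \<longleftrightarrow> (\<forall>k.
     Lbl_set Lbl k (leafs D k) = {} \<and>
     (\<forall>b S S'. b \<subseteq> label_set k \<and> S \<in> fin_subsets (wits D k) \<and> S' \<in> fin_subsets (wits D k) \<and>
        Lbl_set Lbl k S \<subseteq> b \<and> Lbl_set Lbl k S' \<subseteq> b \<longrightarrow>
        (\<forall>u\<in>label_set k - b. Lbl_set Lbl k (intro_vertex_set D k u S) \<subseteq> b \<union> {u}) \<and>
        (\<forall>u\<in>b. Lbl_set Lbl k (forget_vertex_set D k u S) \<subseteq> b - {u}) \<and>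
        (\<forall>u\<in>b. \<forall>v\<in>b. u \<noteq> v \<longrightarrow> Lbl_set Lbl k (intro_edge_set D k u v S) \<subseteq> b) \<and>
        Lbl_set Lbl k (join_set D k S S') \<subseteq> b \<and>
        Lbl_set Lbl k (clean D k S) \<subseteq> b))"

type_synonym relabeling = "nat \<rightharpoonup> nat"
type_synonym action = "nat \<Rightarrow> relabeling \<Rightarrow> witness \<rightharpoonup> witness"

definition relabelings :: "nat \<Rightarrow> relabeling set" where
  "relabelings k = {f. dom f \<subseteq> label_set k \<and> ran f \<subseteq> label_set k \<and> inj_on f (dom f)}"

definition act_set :: "action \<Rightarrow> nat \<Rightarrow> relabeling \<Rightarrow> witness set \<Rightarrow> witness set" where
  "act_set \<rho> k f S = map_image (\<rho> k f) S"

text \<open>The equations for partial maps are required wherever both sides are defined; in the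
  composition law both sides are defined for the same arguments.\<close>

definition witness_action :: "dpcore \<Rightarrow> labelling \<Rightarrow> action \<Rightarrow> bool" where
  "witness_action D Lbl \<rho> \<longleftrightarrow> (\<forall>k. \<forall>f\<in>relabelings k.
     (\<forall>w\<in>wits D k. \<rho> k f w \<noteq> None \<longleftrightarrow> Lbl k w \<subseteq> dom f) \<and>
     (\<forall>w\<in>wits D k. \<forall>x. \<rho> k f w = Some x \<longrightarrow>
        x \<in> wits D k \<and>
        (final D k x \<longleftrightarrow> final D k w) \<and>
        Lbl k x = map_image f (Lbl k w) \<and>
        \<rho> k (map_inverse f) x = Some w \<and>
        (\<forall>f'\<in>relabelings k. f \<subseteq>\<^sub>m f' \<longrightarrow> \<rho> k f' w = \<rho> k f w)) \<and>
     (\<forall>w\<in>wits D k. \<forall>f'\<in>relabelings k. \<rho> k (f \<circ>\<^sub>m f') w = Option.bind (\<rho> k f' w) (\<rho> k f)) \<and>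
     (\<forall>w\<in>wits D k. \<forall>x u u'. \<rho> k f w = Some x \<and> f u = Some u' \<longrightarrow>
        (Lbl_set Lbl k (intro_vertex D k u w) \<subseteq> dom f \<longrightarrow>
           act_set \<rho> k f (intro_vertex D k u w) = intro_vertex D k u' x) \<and>
        (Lbl_set Lbl k (forget_vertex D k u w) \<subseteq> dom f \<longrightarrow>
           act_set \<rho> k f (forget_vertex D k u w) = forget_vertex D k u' x)) \<and>
     (\<forall>w\<in>wits D k. \<forall>x u u' v v'. \<rho> k f w = Some x \<and> f u = Some u' \<and> f v = Some v' \<and> u \<noteq> v \<and>
        Lbl_set Lbl k (intro_edge D k u v w) \<subseteq> dom f \<longrightarrow>
        act_set \<rho> k f (intro_edge D k u v w) = intro_edge D k u' v' x) \<and>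
     (\<forall>w\<in>wits D k. \<forall>w'\<in>wits D k. \<forall>x x'. \<rho> k f w = Some x \<and> \<rho> k f w' = Some x' \<and>
        Lbl_set Lbl k (joins D k w w') \<subseteq> dom f \<longrightarrow>
        act_set \<rho> k f (joins D k w w') = joins D k x x'))"

definition relabel_state :: "action \<Rightarrow> nat \<Rightarrow> relabeling \<Rightarrow> state \<Rightarrow> state" where
  "relabel_state \<rho> k f X = (case X of (b, S) \<Rightarrow> (map_image f b, act_set \<rho> k f S))"

definition relabeled_states :: "action \<Rightarrow> nat \<Rightarrow> state \<Rightarrow> state set" where
  "relabeled_states \<rho> k X = {relabel_state \<rho> k f X | f. f \<in> relabelings k \<and> dom f = fst X}"

definition enumeration :: "'a rel \<Rightarrow> 'a set \<Rightarrow> 'a list" where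
  "enumeration r S = (THE xs. set xs = S \<and> distinct xs \<and> sorted_wrt (\<lambda>x y. (x, y) \<in> r) xs)"

text \<open>In the library relation \<^const>\<open>lexord\<close>, a proper prefix of a list is smaller than the
  list.\<close>

definition state_less :: "witness rel \<Rightarrow> state rel" where
  "state_less r = {((b, S), (b', S')).
     ((sorted_list_of_set b, enumeration r S), (sorted_list_of_set b', enumeration r S'))
       \<in> lexord less_than <*lex*> lexord (r - Id)}"

definition CAN :: "action \<Rightarrow> witness rel \<Rightarrow> nat \<Rightarrow> state \<Rightarrow> state" where
  "CAN \<rho> r k X = (THE Y. Y \<in> relabeled_states \<rho> k X \<and>
     (\<forall>Z\<in>relabeled_states \<rho> k X. Z = Y \<or> (Y, Z) \<in> state_less r))"

definition canonical :: "action \<Rightarrow> witness rel \<Rightarrow> nat \<Rightarrow> state \<Rightarrow> bool" where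
  "canonical \<rho> r k X \<longleftrightarrow> X = CAN \<rho> r k X"

definition unary_successors :: "dpcore \<Rightarrow> nat \<Rightarrow> state \<Rightarrow> state set" where
  "unary_successors D k X = (case X of (b, S) \<Rightarrow>
     {(b \<union> {u}, intro_vertex_set D k u S) | u. u \<in> label_set k - b} \<union>
     {(b - {u}, forget_vertex_set D k u S) | u. u \<in> b} \<union>
     {(b, intro_edge_set D k u v S) | u v. u \<in> b \<and> v \<in> b \<and> u \<noteq> v})"

definition join_successors :: "dpcore \<Rightarrow> action \<Rightarrow> nat \<Rightarrow> state \<Rightarrow> state \<Rightarrow> state set" where
  "join_successors D \<rho> k X X' = (case X of (b, S) \<Rightarrow> case X' of (b', S') \<Rightarrow>
     {(b, join_set D k S (act_set \<rho> k \<pi> S')) | \<pi>.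
        b' = b \<and> \<pi> \<in> relabelings k \<and> dom \<pi> = b \<and> ran \<pi> = b})"

definition canonized_refutation ::
    "dpcore \<Rightarrow> labelling \<Rightarrow> action \<Rightarrow> witness rel \<Rightarrow> nat \<Rightarrow> state list \<Rightarrow> bool" where
  "canonized_refutation D Lbl \<rho> r k R \<longleftrightarrow>
     R \<noteq> [] \<and>
     (\<forall>X\<in>set R. well_formed D Lbl k X \<and> canonical \<rho> r k X) \<and>
     hd R = initial_state D k \<and>
     inconsistent D k (last R) \<and>
     (\<forall>i. 1 \<le> i \<and> i < length R \<longrightarrow>
        (\<exists>j<i. \<exists>X \<in> unary_successors D k (R ! j) \<union> (\<Union>l<i. join_successors D \<rho> k (R ! j) (R ! l)).
           R ! i \<in> relabeled_states \<rho> k X))"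

definition successors :: "dpcore \<Rightarrow> action \<Rightarrow> nat \<Rightarrow> state list \<Rightarrow> state \<Rightarrow> state set" where
  "successors D \<rho> k R X = unary_successors D k X \<union>
     (\<Union>X'\<in>set R. join_successors D \<rho> k X X' \<union> join_successors D \<rho> k X' X)"

definition enqueue ::
    "action \<Rightarrow> witness rel \<Rightarrow> nat \<Rightarrow> state \<Rightarrow> state list \<times> state set \<Rightarrow> state list \<times> state set" where
  "enqueue \<rho> r k X c = (case c of (Y, Seen) \<Rightarrow>
     let Z = CAN \<rho> r k X in if Z \<in> Seen then (Y, Seen) else (Y @ [Z], insert Z Seen))"

datatype outcome = Inclusion_Holds | Returned "state list"

text \<open>A configuration consists of the list \<open>R\<close>, the queue \<open>Y\<close>, the set \<open>Seen\<close>, and a flag telling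
  whether \<open>R\<close> has been returned. The order in which the successors are generated is
  \<open>enum R X\<close>: an arbitrary listing of the finite set \<open>X\<close> which may depend on the history \<open>R\<close>.\<close>

type_synonym config = "state list \<times> state list \<times> state set \<times> bool"

definition test_step :: "dpcore \<Rightarrow> action \<Rightarrow> witness rel \<Rightarrow> (state list \<Rightarrow> state set \<Rightarrow> state list) \<Rightarrow>
    nat \<Rightarrow> config \<Rightarrow> config" where
  "test_step D \<rho> r enum k c = (case c of (R, Y, Seen, ret) \<Rightarrow>
     let X = hd Y; Y' = tl Y; R' = R @ [X] in
     if inconsistent D k X then (R', Y', Seen, True)
     else case fold (enqueue \<rho> r k) (enum R' (successors D \<rho> k R' X)) (Y', Seen) of
            (Y'', Seen'') \<Rightarrow> (R', Y'', Seen'', False))"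

text \<open>The value is \<^const>\<open>None\<close> iff the loop does not terminate.\<close>

definition relabeled_inclusion_test :: "dpcore \<Rightarrow> action \<Rightarrow> witness rel \<Rightarrow>
    (state list \<Rightarrow> state set \<Rightarrow> state list) \<Rightarrow> nat \<Rightarrow> outcome option" where
  "relabeled_inclusion_test D \<rho> r enum k =
     (let Init = CAN \<rho> r k (initial_state D k) in
      map_option (\<lambda>(R, Y, Seen, ret). if ret then Returned R else Inclusion_Holds)
        (while_option (\<lambda>(R, Y, Seen, ret). \<not> ret \<and> Y \<noteq> []) (test_step D \<rho> r enum k)
          ([], [Init], {Init}, False)))"

end

theory Submission
  imports Defs
begin

text \<open>
  By coherence, inclusion means that every legal term \<open>\<tau>\<close> is accepted, i.e. that every state
  \<open>(bag \<tau>, dyn \<tau>)\<close> is consistent. The states arising from terms are closed under relabeling: a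
  relabeling of the bag lifts through the term because it extends to a permutation of all labels
  and the transitions are equivariant. Conversely, relabeling a state relabels its successors, so
  a set of canonical states that contains the initial state and is closed under canonized
  successors contains the canonical form of every state of a term; for joins one uses that the
  canonical bag depends only on the bag, and absorbs the mismatch of the two canonizing
  relabelings in the permutation \<open>\<pi>\<close>. The search therefore ends with such a closed set of
  consistent states or meets an inconsistent state of some term, and its list is a derivation of
  that state.
\<close>

section \<open>Graphs of instructive decompositions\<close>

text \<open>The laws of the action constrain \<open>f u\<close> and the labels of the result. A
  relabeling whose domain is just the bag says nothing about a label that is about to enter it, and
  a relabeling of a smaller bag says nothing about a label that was just forgotten. This is the
  obstacle that extension to all labels removes. Being relabelings of each other is an equivalence
  between well-formed states, so \<open>CAN\<close> is an invariant of the class. Terms themselves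
  are never relabeled: states move within their classes, and a term is recovered from the
  transitions. The two directions rest on different facts. A reported state must come from a term
  although canonization replaces states and joins permute an argument; this is the role of
  \<open>realized\<close>. That nothing is missed follows from closure of the processed list, which
  the queue builds up incrementally: two states meet in a join when the later of them is removed
  from the queue.\<close>

lemma fresh_notin: "finite A \<Longrightarrow> fresh A \<notin> A"
  unfolding fresh_def by (rule LeastI_ex) (simp add: ex_new_if_finite)

lemma inj_on_map_eqD: "inj_on f (dom f) \<Longrightarrow> f x = Some z \<Longrightarrow> f y = Some z \<Longrightarrow> x = y"
  by (metis domI inj_onD)

lemma map_inverse_eq_Some:
  assumes "inj_on f (dom f)"
  shows "map_inverse f y = Some x \<longleftrightarrow> f x = Some y"
proof -
  have "(THE x. f x = Some y) = x" if "f x = Some y" for x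
    using that assms by (intro the_equality) (auto dest: inj_on_map_eqD)
  then show ?thesis by (auto simp: map_inverse_def ran_def)
qed

text \<open>Made for joins: each half embeds into the result by an injective renaming, which keeps
  the two endpoints of every edge distinct.\<close>

lemma card_incident_image:
  assumes "card {v. (e, v) \<in> I} = 2" and "inj_on h {v. (e, v) \<in> I}"
    and "{v'. (e', v') \<in> J} = h ` {v. (e, v) \<in> I}"
  shows "card {v'. (e', v') \<in> J} = 2"
  using assms by (simp add: card_image)

text \<open>Being a graph is not inductive by itself. Injectivity of the label map keeps the
  endpoints of a new edge distinct and makes the gluing of a join injective; the bound on its range
  separates a fresh vertex from the labeled ones.\<close>

lemma build_invariant:
  assumes "legal k \<tau>" and "build \<tau> = (G, \<theta>)"
  shows "is_graph G \<and> dom \<theta> = bag \<tau> \<and> ran \<theta> \<subseteq> verts G \<and> inj_on \<theta> (dom \<theta>)"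
  using assms
proof (induction \<tau> arbitrary: G \<theta>)
  case Leaf
  then show ?case by (auto simp: is_graph_def)
next
  case (IntroVertex u \<tau>)
  obtain G0 \<theta>0 where b: "build \<tau> = (G0, \<theta>0)" by fastforce
  let ?x = "fresh (verts G0)"
  from IntroVertex.IH[OF _ b] IntroVertex.prems(1)
  have IH: "is_graph G0" "dom \<theta>0 = bag \<tau>" "ran \<theta>0 \<subseteq> verts G0" "inj_on \<theta>0 (dom \<theta>0)"
    and u: "u \<notin> bag \<tau>" by auto
  have G: "G = G0\<lparr>verts := insert ?x (verts G0)\<rparr>" "\<theta> = \<theta>0(u \<mapsto> ?x)"
    using IntroVertex.prems(2) b by (auto simp: Let_def)
  have fr: "?x \<notin> verts G0" using IH(1) by (simp add: is_graph_def fresh_notin)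
  have "?x \<notin> ran \<theta>0" using fr IH(3) by auto
  then have "inj_on \<theta> (dom \<theta>)"
    using IH(4) u IH(2) unfolding G inj_on_def by (auto simp: ran_def)
  moreover have "ran \<theta> \<subseteq> verts G" using IH(3) unfolding G by (auto simp: ran_def)
  moreover have "dom \<theta> = insert u (bag \<tau>)" using IH(2) by (simp add: G)
  moreover have "is_graph G" using IH(1) by (auto simp: G is_graph_def)
  ultimately show ?case by simp
next
  case (ForgetVertex u \<tau>)
  obtain G0 \<theta>0 where b: "build \<tau> = (G0, \<theta>0)" by fastforce
  from ForgetVertex.IH[OF _ b] ForgetVertex.prems(1)
  have IH: "is_graph G0" "dom \<theta>0 = bag \<tau>" "ran \<theta>0 \<subseteq> verts G0" "inj_on \<theta>0 (dom \<theta>0)"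
    by auto
  have G: "G = G0" "\<theta> = \<theta>0(u := None)"
    using ForgetVertex.prems(2) b by (auto simp: Let_def)
  have "ran \<theta> \<subseteq> ran \<theta>0" unfolding G by (auto simp: ran_def)
  moreover have "inj_on \<theta> (dom \<theta>)" using IH(4) unfolding G inj_on_def by auto
  moreover have "dom \<theta> = bag \<tau> - {u}" using IH(2) by (simp add: G)
  ultimately show ?case using IH(1,3) by (auto simp: G(1))
next
  case (IntroEdge u v \<tau>)
  obtain G0 \<theta>0 where b: "build \<tau> = (G0, \<theta>0)" by fastforce
  let ?e = "fresh (edges G0)"
  from IntroEdge.IH[OF _ b] IntroEdge.prems(1)
  have IH: "is_graph G0" "dom \<theta>0 = bag \<tau>" "ran \<theta>0 \<subseteq> verts G0" "inj_on \<theta>0 (dom \<theta>0)"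
    and uv: "u \<noteq> v" "u \<in> dom \<theta>0" "v \<in> dom \<theta>0" by auto
  have G: "G = G0\<lparr>edges := insert ?e (edges G0),
      inc := {(?e, the (\<theta>0 u)), (?e, the (\<theta>0 v))} \<union> inc G0\<rparr>" "\<theta> = \<theta>0"
    using IntroEdge.prems(2) b by (auto simp: Let_def)
  have fr: "?e \<notin> edges G0" using IH(1) by (simp add: is_graph_def fresh_notin)
  have ne: "the (\<theta>0 u) \<noteq> the (\<theta>0 v)" using uv IH(4) by (metis domD inj_onD option.sel)
  have inc0: "inc G0 \<subseteq> edges G0 \<times> verts G0" using IH(1) by (simp add: is_graph_def)
  have "{w. (?e, w) \<in> inc G} = {the (\<theta>0 u), the (\<theta>0 v)}" using fr inc0 by (auto simp: G)
  moreover have "{w. (e, w) \<in> inc G} = {w. (e, w) \<in> inc G0}" if "e \<in> edges G0" for e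
    using fr that by (auto simp: G)
  moreover have "the (\<theta>0 u) \<in> verts G0" "the (\<theta>0 v) \<in> verts G0"
    using uv IH(3) by (auto intro: ranI)
  ultimately have "is_graph G" using IH(1) ne by (auto simp: is_graph_def G)
  then show ?case using IH by (auto simp: G)
next
  case (Join \<sigma> \<tau>)
  obtain G1 \<theta>1 where b1: "build \<sigma> = (G1, \<theta>1)" by fastforce
  obtain G2 \<theta>2 where b2: "build \<tau> = (G2, \<theta>2)" by fastforce
  from Join.IH(1)[OF _ b1] Join.prems(1)
  have I1: "is_graph G1" "dom \<theta>1 = bag \<sigma>" "ran \<theta>1 \<subseteq> verts G1" "inj_on \<theta>1 (dom \<theta>1)" by auto
  from Join.IH(2)[OF _ b2] Join.prems(1)
  have I2: "is_graph G2" "dom \<theta>2 = bag \<tau>" "ran \<theta>2 \<subseteq> verts G2" "inj_on \<theta>2 (dom \<theta>2)" by auto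
  define right where
    "right = (\<lambda>x. case (\<theta>1 \<circ>\<^sub>m map_inverse \<theta>2) x of Some y \<Rightarrow> 2 * y | None \<Rightarrow> 2 * x + 1)"
  have G: "G = \<lparr>verts = (\<lambda>x. 2 * x) ` verts G1 \<union> right ` verts G2,
          edges = (\<lambda>e. 2 * e) ` edges G1 \<union> (\<lambda>e. 2 * e + 1) ` edges G2,
          inc = (\<lambda>(e, v). (2 * e, 2 * v)) ` inc G1 \<union> (\<lambda>(e, v). (2 * e + 1, right v)) ` inc G2\<rparr>"
    and \<theta>: "\<theta> = (\<lambda>u. map_option (\<lambda>x. 2 * x) (\<theta>1 u))"
    using Join.prems(2) b1 b2 by (auto simp: Let_def right_def)
  \<comment> \<open>Parity separates the glued right vertices from the others. On the glued ones
    \<open>right\<close> is twice a composite of two injective partial maps,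
    \<open>\<theta>1\<close> after the inverse of \<open>\<theta>2\<close>.\<close>
  have inj: "inj right"
  proof (rule injI)
    fix x y assume "right x = right y"
    then show "x = y"
      using inj_on_map_eqD[OF I1(4)]
      by (auto simp: right_def map_comp_def map_inverse_eq_Some[OF I2(4)] split: option.splits)
        (presburger | metis map_inverse_eq_Some[OF I2(4)] option.inject)+
  qed
  have inc1: "inc G1 \<subseteq> edges G1 \<times> verts G1" and inc2: "inc G2 \<subseteq> edges G2 \<times> verts G2"
    using I1(1) I2(1) by (simp_all add: is_graph_def)
  have "card {v. (e', v) \<in> inc G} = 2" if e': "e' \<in> edges G" for e'
  proof -
    from e' consider e where "e \<in> edges G1" "e' = 2 * e" | e where "e \<in> edges G2" "e' = 2 * e + 1"
      by (auto simp: G)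
    then show ?thesis
    proof cases
      case 1
      show ?thesis
      proof (rule card_incident_image)
        show "card {v. (e, v) \<in> inc G1} = 2" using 1 I1(1) by (simp add: is_graph_def)
        show "inj_on (\<lambda>x. 2 * x) {v. (e, v) \<in> inc G1}" by (simp add: inj_on_def)
        show "{v'. (e', v') \<in> inc G} = (\<lambda>x. 2 * x) ` {v. (e, v) \<in> inc G1}"
          using 1 by (auto simp: G image_iff) (presburger | force)+
      qed
    next
      case 2
      show ?thesis
      proof (rule card_incident_image)
        show "card {v. (e, v) \<in> inc G2} = 2" using 2 I2(1) by (simp add: is_graph_def)
        show "inj_on right {v. (e, v) \<in> inc G2}" using inj by (rule inj_on_subset) simp
        show "{v'. (e', v') \<in> inc G} = right ` {v. (e, v) \<in> inc G2}"
          using 2 by (auto simp: G image_iff) (presburger | force)+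
      qed
    qed
  qed
  moreover have "finite (verts G)" "finite (edges G)"
    using I1(1) I2(1) by (auto simp: G is_graph_def)
  moreover have "inc G \<subseteq> edges G \<times> verts G" using inc1 inc2 by (fastforce simp: G)
  ultimately have "is_graph G" by (simp add: is_graph_def)
  moreover have "dom \<theta> = bag \<sigma>" using I1(2) by (auto simp: \<theta> dom_def)
  moreover have "ran \<theta> \<subseteq> verts G" using I1(3) by (auto simp: \<theta> G ran_def)
  moreover have "inj_on \<theta> (dom \<theta>)"
    using inj_on_map_eqD[OF I1(4)] by (auto simp: \<theta> inj_on_def)
  ultimately show ?case by simp
qed

lemma is_graph_graph_of: "legal k \<tau> \<Longrightarrow> is_graph (graph_of \<tau>)"
  using build_invariant[of k \<tau> "fst (build \<tau>)" "snd (build \<tau>)"] by (simp add: graph_of_def)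

lemma graph_iso_refl: "graph_iso G G"
  unfolding graph_iso_def by (intro exI[of _ id]) auto

text \<open>Membership in the property yields only some accepted term, possibly of another width,
  with an isomorphic graph. Coherence carries its acceptance over to the given term.\<close>

lemma treewidth_subset_iff_accepts:
  assumes "coherent D"
  shows "(\<forall>G. treewidth_le k G \<longrightarrow> G \<in> graph_property D) \<longleftrightarrow> (\<forall>\<tau>. legal k \<tau> \<longrightarrow> accepts D k \<tau>)"
proof (intro iffI allI impI)
  fix \<tau> assume incl: "\<forall>G. treewidth_le k G \<longrightarrow> G \<in> graph_property D" and \<tau>: "legal k \<tau>"
  then have "graph_of \<tau> \<in> graph_property D"
    using is_graph_graph_of graph_iso_refl unfolding treewidth_le_def by blast
  then show "accepts D k \<tau>"
    using assms \<tau> unfolding graph_property_def coherent_def by blast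
qed (auto simp: treewidth_le_def graph_property_def)

section \<open>The order on states\<close>

text \<open>Both heads are least elements of the common set, so antisymmetry identifies
  them.\<close>

lemma sorted_wrt_distinct_unique:
  assumes "antisym r" and "set xs = set ys" and "distinct xs" and "distinct ys"
    and "sorted_wrt (\<lambda>x y. (x, y) \<in> r) xs" and "sorted_wrt (\<lambda>x y. (x, y) \<in> r) ys"
  shows "xs = ys"
  using assms(2-)
proof (induction xs arbitrary: ys)
  case (Cons x xs)
  then obtain y ys' where ys: "ys = y # ys'" by (cases ys) auto
  have "x = y"
  proof (rule ccontr)
    assume "x \<noteq> y"
    then have "(x, y) \<in> r" "(y, x) \<in> r" using Cons.prems by (auto simp: ys)
    with \<open>x \<noteq> y\<close> assms(1) show False by (auto dest: antisymD)
  qed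
  moreover from this have "set xs = set ys'" using Cons.prems by (auto simp: ys)
  ultimately show ?case using Cons.IH[of ys'] Cons.prems by (simp add: ys)
qed simp

lemma linear_order_on_least:
  assumes "linear_order_on A r" and "finite S" and "S \<subseteq> A" and "S \<noteq> {}"
  shows "\<exists>m\<in>S. \<forall>x\<in>S. x \<noteq> m \<longrightarrow> (m, x) \<in> r"
proof (rule Finite_Set.bex_least_element[OF assms(2)])
  show "transp_on S (\<lambda>x y. (x, y) \<in> r)"
    using assms(1) by (auto simp: order_on_defs transp_on_def dest: transD)
  show "totalp_on S (\<lambda>x y. (x, y) \<in> r)"
    using assms(1,3) by (auto simp: order_on_defs totalp_on_def total_on_def)
qed (use assms in auto)

lemma enumeration_exists:
  assumes "linear_order_on A r" and "finite S" and "S \<subseteq> A"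
  shows "\<exists>xs. set xs = S \<and> distinct xs \<and> sorted_wrt (\<lambda>x y. (x, y) \<in> r) xs"
  using assms(2,3)
proof (induction S rule: finite_psubset_induct)
  case (psubset S)
  show ?case
  proof (cases "S = {}")
    case False
    then obtain m where m: "m \<in> S" "\<And>x. x \<in> S \<Longrightarrow> x \<noteq> m \<Longrightarrow> (m, x) \<in> r"
      using linear_order_on_least[OF assms(1) psubset.hyps psubset.prems] by auto
    then obtain xs where "set xs = S - {m}" "distinct xs" "sorted_wrt (\<lambda>x y. (x, y) \<in> r) xs"
      using psubset.IH[of "S - {m}"] psubset.prems by auto
    then have "set (m # xs) = S \<and> distinct (m # xs) \<and> sorted_wrt (\<lambda>x y. (x, y) \<in> r) (m # xs)"
      using m by auto
    then show ?thesis by blast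
  qed simp
qed

text \<open>Since the list determines the set, distinct states never tie in
  \<open>state_less\<close>.\<close>

lemma set_enumeration:
  assumes "linear_order_on A r" and "finite S" and "S \<subseteq> A"
  shows "set (enumeration r S) = S"
proof -
  have anti: "antisym r" using assms(1) by (simp add: order_on_defs)
  have "\<exists>!xs. set xs = S \<and> distinct xs \<and> sorted_wrt (\<lambda>x y. (x, y) \<in> r) xs"
    using enumeration_exists[OF assms] sorted_wrt_distinct_unique[OF anti] by blast
  from theI'[OF this] show ?thesis by (simp add: enumeration_def)
qed

text \<open>Relative to \<open>A\<close>, because \<open>r\<close> is an order of the witnesses only
  and not of all bit strings.\<close>

lemma lexord_total_on:
  assumes "total_on A r" and "set xs \<subseteq> A" and "set ys \<subseteq> A"
  shows "xs = ys \<or> (xs, ys) \<in> lexord r \<or> (ys, xs) \<in> lexord r"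
  using assms(2,3)
proof (induction xs arbitrary: ys)
  case Nil
  then show ?case by (cases ys) auto
next
  case (Cons x xs)
  then show ?case using assms(1) by (cases ys) (auto simp: total_on_def)
qed

lemma state_less_trans:
  assumes "linear_order_on A r" and "(X, Y) \<in> state_less r" and "(Y, Z) \<in> state_less r"
  shows "(X, Z) \<in> state_less r"
proof -
  have "trans (r - Id)" using assms(1) by (simp add: order_on_defs trans_diff_Id)
  then have "trans (lexord less_than <*lex*> lexord (r - Id))"
    by (intro trans_lex_prod lexord_transI) auto
  from transD[OF this] show ?thesis
    using assms(2,3) unfolding state_less_def case_prod_unfold mem_Collect_eq fst_conv snd_conv by blast
qed

lemma state_less_irrefl: "(X, X) \<notin> state_less r"
  by (auto simp: state_less_def lexord_irreflexive)

lemma state_less_total: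
  assumes "linear_order_on A r" and "finite b" and "finite b'"
    and "S \<in> fin_subsets A" and "S' \<in> fin_subsets A"
  shows "(b, S) = (b', S') \<or> ((b, S), (b', S')) \<in> state_less r \<or> ((b', S'), (b, S)) \<in> state_less r"
proof -
  have S: "set (enumeration r S) = S" "S \<subseteq> A" "set (enumeration r S') = S'" "S' \<subseteq> A"
    using assms(4,5) set_enumeration[OF assms(1)] by (auto simp: fin_subsets_def)
  have tot: "total_on A (r - Id)" using assms(1) by (auto simp: order_on_defs total_on_def)
  have 1: "sorted_list_of_set b = sorted_list_of_set b' \<longleftrightarrow> b = b'"
    using assms(2,3) by (metis set_sorted_list_of_set)
  have 2: "enumeration r S = enumeration r S' \<longleftrightarrow> S = S'" using S by metis
  show ?thesis
    using lexord_total_on[OF tot, of "enumeration r S" "enumeration r S'"] S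
      lexord_total_on[of UNIV less_than "sorted_list_of_set b" "sorted_list_of_set b'"]
    by (auto simp: state_less_def 1 2 total_less_than)
qed


section \<open>Relabelings\<close>

lemma relabelingsD:
  assumes "f \<in> relabelings k"
  shows "dom f \<subseteq> label_set k" and "ran f \<subseteq> label_set k" and "inj_on f (dom f)"
  using assms by (auto simp: relabelings_def)

lemma map_inverse_relabeling:
  assumes "f \<in> relabelings k"
  shows "map_inverse f \<in> relabelings k" and "dom (map_inverse f) = ran f"
    and "ran (map_inverse f) = dom f"
proof -
  note inv = map_inverse_eq_Some[OF relabelingsD(3)[OF assms]]
  show d: "dom (map_inverse f) = ran f" by (auto simp: inv dom_def ran_def)
  show r: "ran (map_inverse f) = dom f" by (auto simp: inv dom_def ran_def)
  have "inj_on (map_inverse f) (dom (map_inverse f))"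
    by (rule inj_onI) (metis domD inv option.inject)
  then show "map_inverse f \<in> relabelings k"
    using d r relabelingsD[OF assms] by (simp add: relabelings_def)
qed

lemma map_comp_relabeling:
  assumes "f \<in> relabelings k" and "g \<in> relabelings k"
  shows "f \<circ>\<^sub>m g \<in> relabelings k"
proof -
  have "dom (f \<circ>\<^sub>m g) \<subseteq> dom g" "ran (f \<circ>\<^sub>m g) \<subseteq> ran f"
    by (auto simp: map_comp_Some_iff ran_def)
  moreover have "inj_on (f \<circ>\<^sub>m g) (dom (f \<circ>\<^sub>m g))"
  proof (rule inj_onI)
    fix x y assume "x \<in> dom (f \<circ>\<^sub>m g)" "(f \<circ>\<^sub>m g) x = (f \<circ>\<^sub>m g) y"
    then obtain z where "(f \<circ>\<^sub>m g) x = Some z" "(f \<circ>\<^sub>m g) y = Some z"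
      by (metis domD)
    then obtain x' y' where *: "g x = Some x'" "f x' = Some z" "g y = Some y'" "f y' = Some z"
      unfolding map_comp_Some_iff by blast
    then have "x' = y'" using inj_on_map_eqD[OF relabelingsD(3)[OF assms(1)]] by blast
    with * show "x = y" using inj_on_map_eqD[OF relabelingsD(3)[OF assms(2)]] by blast
  qed
  ultimately show ?thesis using relabelingsD(1)[OF assms(2)] relabelingsD(2)[OF assms(1)]
    unfolding relabelings_def by blast
qed

lemma restrict_map_relabeling: "f \<in> relabelings k \<Longrightarrow> f |` b \<in> relabelings k"
  unfolding relabelings_def by (auto simp: ran_def restrict_map_def inj_on_def dom_def split: if_splits)

lemma map_image_dom: "dom f = b \<Longrightarrow> map_image f b = ran f"
  by (auto simp: map_image_def ran_def)

lemma map_image_mono: "A \<subseteq> B \<Longrightarrow> map_image f A \<subseteq> map_image f B"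
  by (auto simp: map_image_def)

lemma map_image_le: "f \<subseteq>\<^sub>m f' \<Longrightarrow> A \<subseteq> dom f \<Longrightarrow> map_image f' A = map_image f A"
  unfolding map_image_def map_le_def by (metis (lifting) subsetD)

lemma map_image_UN: "map_image f (\<Union>x\<in>A. B x) = (\<Union>x\<in>A. map_image f (B x))"
  by (auto simp: map_image_def)

lemma map_image_comp: "map_image (f \<circ>\<^sub>m g) A = map_image f (map_image g A)"
  by (auto simp: map_image_def map_comp_Some_iff)

lemma map_image_inverse:
  assumes "inj_on f (dom f)" and "A \<subseteq> dom f"
  shows "map_image (map_inverse f) (map_image f A) = A"
  using assms(2) inj_on_map_eqD[OF assms(1)]
  by (fastforce simp: map_image_def map_inverse_eq_Some[OF assms(1)])

text \<open>Domain and range are equally large, hence so are their complements in the label set. Any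
  bijection \<open>h\<close> between the complements completes \<open>g\<close>.\<close>

lemma relabeling_extends_to_label_set:
  assumes "g \<in> relabelings k"
  obtains f where "f \<in> relabelings k" and "dom f = label_set k" and "g \<subseteq>\<^sub>m f"
proof -
  define L where "L = label_set k"
  note g = relabelingsD[OF assms, folded L_def]
  have finL: "finite L" by (simp add: L_def)
  have fin: "finite (dom g)" "finite (ran g)" using g(1,2) finL by (auto intro: finite_subset)
  have "bij_betw (the \<circ> g) (dom g) (ran g)"
    unfolding bij_betw_def
  proof
    show "inj_on (the \<circ> g) (dom g)"
      using inj_on_map_eqD[OF g(3)] by (auto intro!: inj_onI)
    show "(the \<circ> g) ` dom g = ran g" by (force simp: ran_def image_iff)
  qed
  then have "card (dom g) = card (ran g)" by (rule bij_betw_same_card)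
  then have "card (L - dom g) = card (L - ran g)"
    using g fin finL by (simp add: card_Diff_subset)
  then obtain h where h: "bij_betw h (L - dom g) (L - ran g)"
    using finL by (meson finite_Diff finite_same_card_bij)
  define f where "f = (\<lambda>x. if x \<in> dom g then g x else if x \<in> L then Some (h x) else None)"
  have d: "dom f = L" using g(1) by (auto simp: f_def dom_def)
  have hr: "h x \<in> L - ran g" if "x \<in> L - dom g" for x
    using h that unfolding bij_betw_def by blast
  have "ran f \<subseteq> L"
  proof
    fix y assume "y \<in> ran f"
    then obtain x where "f x = Some y" by (auto simp: ran_def)
    then show "y \<in> L"
      using hr[of x] g(2) ranI[of g x y] by (auto simp: f_def split: if_splits)
  qed
  moreover have "inj_on f (dom f)"
  proof (rule inj_onI)
    fix x y assume xy: "x \<in> dom f" "y \<in> dom f" "f x = f y"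
    consider "x \<in> dom g" "y \<in> dom g" | "x \<in> dom g" "y \<notin> dom g" | "x \<notin> dom g" "y \<in> dom g"
      | "x \<notin> dom g" "y \<notin> dom g" by blast
    then show "x = y"
    proof cases
      case 1 then show ?thesis using xy g(3) by (auto simp: f_def inj_on_def)
    next
      case 2 then show ?thesis using xy hr[of y] ranI[of g x "h y"] unfolding d by (auto simp: f_def)
    next
      case 3 then show ?thesis using xy hr[of x] ranI[of g y "h x"] unfolding d by (auto simp: f_def)
    next
      case 4 then show ?thesis using xy h unfolding d by (auto simp: f_def bij_betw_def inj_on_def)
    qed
  qed
  ultimately have "f \<in> relabelings k" using d by (simp add: relabelings_def L_def)
  moreover have "g \<subseteq>\<^sub>m f" by (auto simp: map_le_def f_def)
  ultimately show ?thesis using d that L_def by blast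
qed

lemma unary_successorsI:
  shows "u \<in> label_set k - b \<Longrightarrow> (b \<union> {u}, intro_vertex_set D k u S) \<in> unary_successors D k (b, S)"
    and "u \<in> b \<Longrightarrow> (b - {u}, forget_vertex_set D k u S) \<in> unary_successors D k (b, S)"
    and "u \<in> b \<Longrightarrow> v \<in> b \<Longrightarrow> u \<noteq> v \<Longrightarrow>
      (b, intro_edge_set D k u v S) \<in> unary_successors D k (b, S)"
  unfolding unary_successors_def prod.case by blast+

section \<open>Equivariance of the transitions\<close>

locale relabeled_core =
  fixes D :: dpcore and Lbl :: labelling and \<rho> :: action and k :: nat
  assumes core: "is_dpcore D"
    and interface: "interface_respecting D Lbl"
    and cleaning: "identity_cleaning D"
    and action: "witness_action D Lbl \<rho>"
begin

lemmas action_spec = action[unfolded witness_action_def, THEN spec[of _ k], THEN bspec]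

lemma action_defined:
  "f \<in> relabelings k \<Longrightarrow> w \<in> wits D k \<Longrightarrow> Lbl k w \<subseteq> dom f \<Longrightarrow> \<exists>x. \<rho> k f w = Some x"
  using action_spec[THEN conjunct1] by blast

lemma actionD:
  assumes "f \<in> relabelings k" and "w \<in> wits D k" and "\<rho> k f w = Some x"
  shows "x \<in> wits D k" and "final D k x \<longleftrightarrow> final D k w" and "Lbl k x = map_image f (Lbl k w)"
    and "\<rho> k (map_inverse f) x = Some w"
    and "f' \<in> relabelings k \<Longrightarrow> f \<subseteq>\<^sub>m f' \<Longrightarrow> \<rho> k f' w = Some x"
  using action_spec[OF assms(1), THEN conjunct2, THEN conjunct1, THEN bspec, OF assms(2),
      THEN spec, THEN mp, OF assms(3)] assms(3)
  by metis+

lemma action_comp: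
  "f \<in> relabelings k \<Longrightarrow> f' \<in> relabelings k \<Longrightarrow> w \<in> wits D k \<Longrightarrow>
    \<rho> k (f \<circ>\<^sub>m f') w = Option.bind (\<rho> k f' w) (\<rho> k f)"
  using action_spec[THEN conjunct2, THEN conjunct2, THEN conjunct1] by simp

lemma action_transitions:
  assumes "f \<in> relabelings k" and "w \<in> wits D k" and "\<rho> k f w = Some x" and "f u = Some u'"
  shows "Lbl_set Lbl k (intro_vertex D k u w) \<subseteq> dom f \<Longrightarrow>
      act_set \<rho> k f (intro_vertex D k u w) = intro_vertex D k u' x"
    and "Lbl_set Lbl k (forget_vertex D k u w) \<subseteq> dom f \<Longrightarrow>
      act_set \<rho> k f (forget_vertex D k u w) = forget_vertex D k u' x"
    and "Lbl_set Lbl k (intro_edge D k u v w) \<subseteq> dom f \<Longrightarrow> f v = Some v' \<Longrightarrow> u \<noteq> v \<Longrightarrow>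
      act_set \<rho> k f (intro_edge D k u v w) = intro_edge D k u' v' x"
  using action_spec[OF assms(1), THEN conjunct2, THEN conjunct2, THEN conjunct2] assms(2-)
  by metis+

lemma action_joins:
  assumes "f \<in> relabelings k" and "w \<in> wits D k" and "\<rho> k f w = Some x"
    and "w' \<in> wits D k" and "\<rho> k f w' = Some x'" and "Lbl_set Lbl k (joins D k w w') \<subseteq> dom f"
  shows "act_set \<rho> k f (joins D k w w') = joins D k x x'"
  using action_spec[OF assms(1), THEN conjunct2, THEN conjunct2, THEN conjunct2, THEN conjunct2, THEN conjunct2]
    assms(2-) by metis

lemma well_formedD:
  assumes "well_formed D Lbl k (b, S)"
  shows "b \<subseteq> label_set k" and "S \<in> fin_subsets (wits D k)" and "Lbl_set Lbl k S \<subseteq> b"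
    and "S \<subseteq> wits D k" and "finite S"
  using assms by (auto simp: well_formed_def fin_subsets_def)

lemma act_set_fin:
  assumes "f \<in> relabelings k" and "S \<in> fin_subsets (wits D k)"
  shows "act_set \<rho> k f S \<in> fin_subsets (wits D k)"
proof -
  have "act_set \<rho> k f S \<subseteq> (\<lambda>w. the (\<rho> k f w)) ` S" by (force simp: act_set_def map_image_def)
  then have "finite (act_set \<rho> k f S)"
    using assms(2) by (auto simp: fin_subsets_def intro: finite_subset)
  moreover have "act_set \<rho> k f S \<subseteq> wits D k"
    using actionD(1)[OF assms(1)] assms(2) by (auto simp: act_set_def map_image_def fin_subsets_def)
  ultimately show ?thesis by (simp add: fin_subsets_def)
qed

lemma Lbl_act_set:
  assumes "f \<in> relabelings k" and "S \<subseteq> wits D k"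
  shows "Lbl_set Lbl k (act_set \<rho> k f S) \<subseteq> map_image f (Lbl_set Lbl k S)"
  using actionD(3)[OF assms(1)] assms(2) by (fastforce simp: act_set_def map_image_def Lbl_set_def)

text \<open>The effect of a relabeling on a witness is decided on the labels of that witness, so its
  domain may grow or shrink as long as it covers them.\<close>

lemma act_set_extend:
  assumes "f \<in> relabelings k" and "f' \<in> relabelings k" and "f \<subseteq>\<^sub>m f'" and "S \<subseteq> wits D k"
    and "Lbl_set Lbl k S \<subseteq> dom f"
  shows "act_set \<rho> k f' S = act_set \<rho> k f S"
proof -
  have "\<rho> k f' w = \<rho> k f w" if w: "w \<in> S" for w
  proof -
    have "Lbl k w \<subseteq> dom f" using w assms(5) by (auto simp: Lbl_set_def)
    then obtain x where "\<rho> k f w = Some x" using action_defined[OF assms(1) subsetD[OF assms(4) w]] by blast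
    then show ?thesis using actionD(5)[OF assms(1) subsetD[OF assms(4) w] _ assms(2,3)] by simp
  qed
  then show ?thesis by (auto simp: act_set_def map_image_def)
qed

lemma act_set_comp:
  assumes "f \<in> relabelings k" and "g \<in> relabelings k" and "S \<subseteq> wits D k"
  shows "act_set \<rho> k (f \<circ>\<^sub>m g) S = act_set \<rho> k f (act_set \<rho> k g S)"
proof -
  have "\<rho> k (f \<circ>\<^sub>m g) w = Some y \<longleftrightarrow> (\<exists>x. \<rho> k g w = Some x \<and> \<rho> k f x = Some y)" if "w \<in> S" for w y
    using action_comp[OF assms(1,2) subsetD[OF assms(3) that]] by (simp add: bind_eq_Some_conv)
  then show ?thesis by (auto simp: act_set_def map_image_def)
qed

lemma act_set_inverse:
  assumes "f \<in> relabelings k" and "S \<subseteq> wits D k" and "Lbl_set Lbl k S \<subseteq> dom f"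
  shows "act_set \<rho> k (map_inverse f) (act_set \<rho> k f S) = S"
proof -
  have inv: "\<rho> k (map_inverse f) x = Some w" if "w \<in> S" "\<rho> k f w = Some x" for w x
    using actionD(4) assms(1,2) that by blast
  moreover have "\<exists>x. \<rho> k f w = Some x" if "w \<in> S" for w
    using action_defined[OF assms(1)] assms(2,3) that by (force simp: Lbl_set_def)
  ultimately show ?thesis by (fastforce simp: act_set_def map_image_def)
qed

lemma act_set_final:
  assumes "f \<in> relabelings k" and "S \<subseteq> wits D k" and "\<exists>w\<in>act_set \<rho> k f S. final D k w"
  shows "\<exists>w\<in>S. final D k w"
  using assms actionD(2)[OF assms(1)] by (auto simp: act_set_def map_image_def)

text \<open>Inverse and composition law together force the empty relabeling to act trivially.\<close>

lemma action_empty: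
  assumes "w \<in> wits D k" and "Lbl k w = {}"
  shows "\<rho> k Map.empty w = Some w"
proof -
  have e: "Map.empty \<in> relabelings k" by (simp add: relabelings_def)
  obtain x where x: "\<rho> k Map.empty w = Some x" using action_defined[OF e] assms by auto
  have "map_inverse Map.empty = (Map.empty :: relabeling)" by (auto simp: map_inverse_def)
  then have "\<rho> k Map.empty x = Some w" using actionD(4)[OF e assms(1) x] by simp
  moreover have "Map.empty \<circ>\<^sub>m Map.empty = (Map.empty :: relabeling)" by (simp add: map_comp_def)
  ultimately show ?thesis using action_comp[OF e e assms(1)] x by simp
qed

text \<open>Pointwise equivariance lifts to sets because the label hypothesis gives every witness in
  \<open>S\<close> an image; a witness without one could contribute to the left side only.\<close>

lemma act_set_UN:
  assumes "f \<in> relabelings k" and "S \<subseteq> wits D k" and "Lbl_set Lbl k S \<subseteq> dom f"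
    and "\<And>w x. w \<in> S \<Longrightarrow> \<rho> k f w = Some x \<Longrightarrow> act_set \<rho> k f (F w) = F' x"
  shows "act_set \<rho> k f (\<Union>w\<in>S. F w) = (\<Union>x\<in>act_set \<rho> k f S. F' x)"
proof -
  have "\<exists>x. \<rho> k f w = Some x" if "w \<in> S" for w
    using action_defined[OF assms(1)] assms(2,3) that by (force simp: Lbl_set_def)
  then have "(\<Union>w\<in>S. act_set \<rho> k f (F w)) = (\<Union>x\<in>act_set \<rho> k f S. F' x)"
    using assms(4) by (fastforce simp: act_set_def[of \<rho> k f S] map_image_def)
  then show ?thesis by (simp add: act_set_def map_image_UN)
qed

lemma Lbl_set_UN: "Lbl_set Lbl k (\<Union>w\<in>S. F w) \<subseteq> c \<longleftrightarrow> (\<forall>w\<in>S. Lbl_set Lbl k (F w) \<subseteq> c)"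
  by (auto simp: Lbl_set_def)

lemma act_set_transitions:
  assumes "f \<in> relabelings k" and "S \<subseteq> wits D k" and "Lbl_set Lbl k S \<subseteq> dom f" and "f u = Some u'"
  shows "Lbl_set Lbl k (intro_vertex_set D k u S) \<subseteq> dom f \<Longrightarrow>
      act_set \<rho> k f (intro_vertex_set D k u S) = intro_vertex_set D k u' (act_set \<rho> k f S)"
    and "Lbl_set Lbl k (forget_vertex_set D k u S) \<subseteq> dom f \<Longrightarrow>
      act_set \<rho> k f (forget_vertex_set D k u S) = forget_vertex_set D k u' (act_set \<rho> k f S)"
    and "Lbl_set Lbl k (intro_edge_set D k u v S) \<subseteq> dom f \<Longrightarrow> f v = Some v' \<Longrightarrow> u \<noteq> v \<Longrightarrow>
      act_set \<rho> k f (intro_edge_set D k u v S) = intro_edge_set D k u' v' (act_set \<rho> k f S)"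
proof -
  show "Lbl_set Lbl k (intro_vertex_set D k u S) \<subseteq> dom f \<Longrightarrow>
      act_set \<rho> k f (intro_vertex_set D k u S) = intro_vertex_set D k u' (act_set \<rho> k f S)"
    unfolding intro_vertex_set_def Lbl_set_UN
    by (rule act_set_UN[OF assms(1-3)]) (simp add: action_transitions(1)[OF assms(1) subsetD[OF assms(2)] _ assms(4)])
  show "Lbl_set Lbl k (forget_vertex_set D k u S) \<subseteq> dom f \<Longrightarrow>
      act_set \<rho> k f (forget_vertex_set D k u S) = forget_vertex_set D k u' (act_set \<rho> k f S)"
    unfolding forget_vertex_set_def Lbl_set_UN
    by (rule act_set_UN[OF assms(1-3)]) (simp add: action_transitions(2)[OF assms(1) subsetD[OF assms(2)] _ assms(4)])
  show "Lbl_set Lbl k (intro_edge_set D k u v S) \<subseteq> dom f \<Longrightarrow> f v = Some v' \<Longrightarrow> u \<noteq> v \<Longrightarrow>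
      act_set \<rho> k f (intro_edge_set D k u v S) = intro_edge_set D k u' v' (act_set \<rho> k f S)"
    unfolding intro_edge_set_def Lbl_set_UN
    by (rule act_set_UN[OF assms(1-3)]) (simp add: action_transitions(3)[OF assms(1) subsetD[OF assms(2)] _ assms(4)])
qed

lemma act_set_join:
  assumes "f \<in> relabelings k" and "S \<subseteq> wits D k" and "Lbl_set Lbl k S \<subseteq> dom f"
    and "S' \<subseteq> wits D k" and "Lbl_set Lbl k S' \<subseteq> dom f"
    and "Lbl_set Lbl k (join_set D k S S') \<subseteq> dom f"
  shows "act_set \<rho> k f (join_set D k S S') = join_set D k (act_set \<rho> k f S) (act_set \<rho> k f S')"
  unfolding join_set_def
proof (rule act_set_UN[OF assms(1-3)])
  fix w x assume w: "w \<in> S" "\<rho> k f w = Some x"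
  show "act_set \<rho> k f (\<Union>w'\<in>S'. joins D k w w') = (\<Union>x'\<in>act_set \<rho> k f S'. joins D k x x')"
  proof (rule act_set_UN[OF assms(1,4,5)])
    fix w' x' assume w': "w' \<in> S'" "\<rho> k f w' = Some x'"
    have "Lbl_set Lbl k (joins D k w w') \<subseteq> dom f"
      using assms(6) w(1) w'(1) unfolding join_set_def Lbl_set_UN by blast
    then show "act_set \<rho> k f (joins D k w w') = joins D k x x'"
      using action_joins[OF assms(1)] w w' assms(2,4) by blast
  qed
qed

section \<open>Relabeled states and their successors\<close>

lemma fin_subsets_UN:
  assumes "S \<in> fin_subsets A" and "\<And>w. w \<in> A \<Longrightarrow> F w \<in> fin_subsets A"
  shows "(\<Union>w\<in>S. F w) \<in> fin_subsets A"
  using assms unfolding fin_subsets_def by blast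

lemma transitions_fin:
  assumes "S \<in> fin_subsets (wits D k)"
  shows "u \<in> label_set k \<Longrightarrow> intro_vertex_set D k u S \<in> fin_subsets (wits D k)"
    and "u \<in> label_set k \<Longrightarrow> forget_vertex_set D k u S \<in> fin_subsets (wits D k)"
    and "u \<in> label_set k \<Longrightarrow> v \<in> label_set k \<Longrightarrow> u \<noteq> v \<Longrightarrow>
      intro_edge_set D k u v S \<in> fin_subsets (wits D k)"
    and "S' \<in> fin_subsets (wits D k) \<Longrightarrow> join_set D k S S' \<in> fin_subsets (wits D k)"
proof -
  note spec = core[unfolded is_dpcore_def, THEN spec[of _ k]]
  show "u \<in> label_set k \<Longrightarrow> intro_vertex_set D k u S \<in> fin_subsets (wits D k)"
    unfolding intro_vertex_set_def using spec by (intro fin_subsets_UN[OF assms]) blast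
  show "u \<in> label_set k \<Longrightarrow> forget_vertex_set D k u S \<in> fin_subsets (wits D k)"
    unfolding forget_vertex_set_def using spec by (intro fin_subsets_UN[OF assms]) blast
  show "u \<in> label_set k \<Longrightarrow> v \<in> label_set k \<Longrightarrow> u \<noteq> v \<Longrightarrow>
      intro_edge_set D k u v S \<in> fin_subsets (wits D k)"
    unfolding intro_edge_set_def using spec by (intro fin_subsets_UN[OF assms]) blast
  show "S' \<in> fin_subsets (wits D k) \<Longrightarrow> join_set D k S S' \<in> fin_subsets (wits D k)"
    unfolding join_set_def using spec by (intro fin_subsets_UN[OF assms] fin_subsets_UN[of S']) blast+
qed

lemma interface_transitions:
  assumes "well_formed D Lbl k (b, S)" and "well_formed D Lbl k (b, S')"
  shows "u \<in> label_set k - b \<Longrightarrow> Lbl_set Lbl k (intro_vertex_set D k u S) \<subseteq> b \<union> {u}"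
    and "u \<in> b \<Longrightarrow> Lbl_set Lbl k (forget_vertex_set D k u S) \<subseteq> b - {u}"
    and "u \<in> b \<Longrightarrow> v \<in> b \<Longrightarrow> u \<noteq> v \<Longrightarrow> Lbl_set Lbl k (intro_edge_set D k u v S) \<subseteq> b"
    and "Lbl_set Lbl k (join_set D k S S') \<subseteq> b"
  using interface[unfolded interface_respecting_def, THEN spec[of _ k], THEN conjunct2,
      THEN spec[of _ b], THEN spec[of _ S], THEN spec[of _ S'], THEN mp]
    well_formedD(1-3)[OF assms(1)] well_formedD(2,3)[OF assms(2)]
  by simp_all

lemma well_formed_initial: "well_formed D Lbl k (initial_state D k)"
  using core interface by (simp add: well_formed_def initial_state_def is_dpcore_def interface_respecting_def)

lemma well_formed_unary:
  assumes "well_formed D Lbl k X" and "Z \<in> unary_successors D k X"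
  shows "well_formed D Lbl k Z"
proof -
  obtain b S where X: "X = (b, S)" by fastforce
  note wf = well_formedD[OF assms(1)[unfolded X]]
  note i = interface_transitions[OF assms(1)[unfolded X] assms(1)[unfolded X]]
  consider u where "Z = (b \<union> {u}, intro_vertex_set D k u S)" "u \<in> label_set k - b"
    | u where "Z = (b - {u}, forget_vertex_set D k u S)" "u \<in> b"
    | u v where "Z = (b, intro_edge_set D k u v S)" "u \<in> b" "v \<in> b" "u \<noteq> v"
    using assms(2) unfolding X unary_successors_def by auto
  then show ?thesis
  proof cases
    case (1 u)
    then show ?thesis using i(1)[of u] wf(1) transitions_fin(1)[OF wf(2), of u]
      by (simp add: well_formed_def)
  next
    case (2 u)
    then have "u \<in> label_set k" using wf(1) by blast
    with 2 show ?thesis using i(2)[of u] wf(1) transitions_fin(2)[OF wf(2), of u]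
      by (auto simp: well_formed_def)
  next
    case (3 u v)
    then have "u \<in> label_set k" "v \<in> label_set k" using wf(1) by blast+
    with 3 show ?thesis using i(3)[of u v] wf(1) transitions_fin(3)[OF wf(2), of u v]
      by (simp add: well_formed_def)
  qed
qed

lemma well_formed_join_set:
  assumes "well_formed D Lbl k (b, S)" and "well_formed D Lbl k (b, S')"
  shows "well_formed D Lbl k (b, join_set D k S S')"
proof -
  note wf = well_formedD[OF assms(1)] well_formedD[OF assms(2)]
  have "Lbl_set Lbl k (join_set D k S S') \<subseteq> b"
    using interface_transitions(4)[OF assms] .
  then show ?thesis using wf transitions_fin(4) by (simp add: well_formed_def)
qed

section \<open>Relabeling as an equivalence between well-formed states\<close>

lemma relabel_state_extend:
  assumes "well_formed D Lbl k X" and "g \<in> relabelings k" and "f \<in> relabelings k"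
    and "g \<subseteq>\<^sub>m f" and "fst X \<subseteq> dom g"
  shows "relabel_state \<rho> k f X = relabel_state \<rho> k g X"
proof -
  obtain b S where X: "X = (b, S)" by fastforce
  note wf = well_formedD[OF assms(1)[unfolded X]]
  show ?thesis
    using act_set_extend[OF assms(2-4) wf(4)] wf(3) map_image_le[OF assms(4)] assms(5)
    by (auto simp: relabel_state_def X)
qed

text \<open>\<open>relabeled_states\<close> asks for a domain equal to the bag; a larger relabeling
  acts like its restriction to the bag.\<close>

lemma relabel_state_in_relabeled_states:
  assumes "well_formed D Lbl k X" and "f \<in> relabelings k" and "fst X \<subseteq> dom f"
  shows "relabel_state \<rho> k f X \<in> relabeled_states \<rho> k X"
proof -
  have d: "dom (f |` fst X) = fst X" using assms(3) by (simp add: Int_absorb1)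
  have "f |` fst X \<subseteq>\<^sub>m f" by (simp add: map_le_def)
  then have "relabel_state \<rho> k f X = relabel_state \<rho> k (f |` fst X) X"
    using relabel_state_extend[OF assms(1) restrict_map_relabeling[OF assms(2)] assms(2)] d
    by (metis order_refl)
  then show ?thesis
    using d restrict_map_relabeling[OF assms(2)] unfolding relabeled_states_def by blast
qed

lemma relabeled_statesE:
  assumes "Y \<in> relabeled_states \<rho> k X"
  obtains f where "f \<in> relabelings k" and "dom f = fst X" and "Y = relabel_state \<rho> k f X"
  using assms by (auto simp: relabeled_states_def)

text \<open>With the previous restriction, a class can be described by relabelings defined on all
  labels, which also have a value at labels outside the bag.\<close>

lemma relabeled_states_full:
  assumes "well_formed D Lbl k X" and "Y \<in> relabeled_states \<rho> k X"
  obtains f where "f \<in> relabelings k" and "dom f = label_set k" and "Y = relabel_state \<rho> k f X"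
proof -
  obtain g where g: "g \<in> relabelings k" "dom g = fst X" "Y = relabel_state \<rho> k g X"
    using relabeled_statesE[OF assms(2)] .
  obtain f where "f \<in> relabelings k" "dom f = label_set k" "g \<subseteq>\<^sub>m f"
    using relabeling_extends_to_label_set[OF g(1)] .
  then show ?thesis using relabel_state_extend[OF assms(1) g(1)] g(2,3) that by simp
qed

lemma well_formed_relabeled:
  assumes "well_formed D Lbl k X" and "Y \<in> relabeled_states \<rho> k X"
  shows "well_formed D Lbl k Y"
proof -
  obtain b S where X: "X = (b, S)" by fastforce
  note wf = well_formedD[OF assms(1)[unfolded X]]
  obtain f where f: "f \<in> relabelings k" "dom f = b" "Y = (map_image f b, act_set \<rho> k f S)"
    using assms(2) by (auto elim!: relabeled_statesE simp: X relabel_state_def)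
  have "Lbl_set Lbl k (act_set \<rho> k f S) \<subseteq> map_image f b"
    using Lbl_act_set[OF f(1) wf(4)] map_image_mono[OF wf(3)] by (rule order_trans)
  moreover have "map_image f b \<subseteq> label_set k"
    using relabelingsD(2)[OF f(1)] f(2) by (simp add: map_image_dom)
  ultimately show ?thesis using f(3) act_set_fin[OF f(1) wf(2)] by (simp add: well_formed_def)
qed

lemma relabeled_states_sym:
  assumes "well_formed D Lbl k X" and "Y \<in> relabeled_states \<rho> k X"
  shows "X \<in> relabeled_states \<rho> k Y"
proof -
  obtain b S where X: "X = (b, S)" by fastforce
  note wf = well_formedD[OF assms(1)[unfolded X]]
  obtain f where f: "f \<in> relabelings k" "dom f = b" "Y = (map_image f b, act_set \<rho> k f S)"
    using assms(2) by (auto elim!: relabeled_statesE simp: X relabel_state_def)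
  have "relabel_state \<rho> k (map_inverse f) Y = X"
    using act_set_inverse[OF f(1) wf(4)] map_image_inverse[OF relabelingsD(3)[OF f(1)]] wf(3) f(2)
    by (auto simp: f(3) X relabel_state_def)
  moreover have "dom (map_inverse f) = fst Y"
    using map_inverse_relabeling(2)[OF f(1)] f(2,3) by (simp add: map_image_dom)
  ultimately show ?thesis
    using map_inverse_relabeling(1)[OF f(1)] unfolding relabeled_states_def by blast
qed

lemma relabeled_states_trans:
  assumes "well_formed D Lbl k X" and "Y \<in> relabeled_states \<rho> k X" and "Z \<in> relabeled_states \<rho> k Y"
  shows "Z \<in> relabeled_states \<rho> k X"
proof -
  obtain b S where X: "X = (b, S)" by fastforce
  note wf = well_formedD[OF assms(1)[unfolded X]]
  obtain f where f: "f \<in> relabelings k" "dom f = b" "Y = (map_image f b, act_set \<rho> k f S)"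
    using assms(2) by (auto elim!: relabeled_statesE simp: X relabel_state_def)
  obtain g where g: "g \<in> relabelings k" "dom g = fst Y" "Z = relabel_state \<rho> k g Y"
    using assms(3) by (auto elim!: relabeled_statesE)
  have "Z = relabel_state \<rho> k (g \<circ>\<^sub>m f) X"
    by (simp add: g(3) f(3) X relabel_state_def map_image_comp act_set_comp[OF g(1) f(1) wf(4)])
  moreover have "dom (g \<circ>\<^sub>m f) = fst X"
  proof -
    have "dom g = ran f" using g(2) f(2,3) by (simp add: map_image_dom)
    then have "(g \<circ>\<^sub>m f) x = None \<longleftrightarrow> f x = None" for x
      by (cases "f x") (auto simp: map_comp_def dest: ranI)
    then show ?thesis using f(2) by (auto simp: X dom_def)
  qed
  ultimately show ?thesis
    using map_comp_relabeling[OF g(1) f(1)] unfolding relabeled_states_def by blast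
qed

text \<open>Symmetry and transitivity make these sets equivalence classes, so a minimum taken over
  one of them does not depend on the representative.\<close>

lemma relabeled_states_eq:
  assumes "well_formed D Lbl k X" and "Y \<in> relabeled_states \<rho> k X"
  shows "relabeled_states \<rho> k Y = relabeled_states \<rho> k X"
proof (intro equalityI subsetI)
  show "Z \<in> relabeled_states \<rho> k X" if "Z \<in> relabeled_states \<rho> k Y" for Z
    using relabeled_states_trans[OF assms that] .
  show "Z \<in> relabeled_states \<rho> k Y" if "Z \<in> relabeled_states \<rho> k X" for Z
    using relabeled_states_trans[OF well_formed_relabeled[OF assms] relabeled_states_sym[OF assms] that] .
qed

section \<open>Relabeling commutes with the successor relations\<close>

lemma relabel_unary_successor:
  assumes "well_formed D Lbl k X" and "Z \<in> unary_successors D k X"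
    and f: "f \<in> relabelings k" "dom f = label_set k"
  shows "relabel_state \<rho> k f Z \<in> unary_successors D k (relabel_state \<rho> k f X)"
proof -
  obtain b S where X: "X = (b, S)" by fastforce
  note wf = well_formedD[OF assms(1)[unfolded X]]
  obtain c T where Z: "Z = (c, T)" by fastforce
  have lbl: "Lbl_set Lbl k S \<subseteq> dom f" "Lbl_set Lbl k T \<subseteq> dom f"
    using wf well_formedD[OF well_formed_unary[OF assms(1,2), unfolded Z]] f(2) by auto
  note inj = inj_on_map_eqD[OF relabelingsD(3)[OF f(1)]]
  note tr = act_set_transitions[OF f(1) wf(4) lbl(1)]
  \<comment> \<open>An introduced \<open>u\<close> lies outside \<open>b\<close>; the full domain of
    \<open>f\<close> still gives it an image, and injectivity keeps that image outside the image of
    \<open>b\<close>.\<close>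
  have val: "\<exists>u'\<in>label_set k. f u = Some u'" if "u \<in> label_set k" for u
    using that f(2) relabelingsD(2)[OF f(1)] by (metis domD ranI subsetD)
  consider u where "c = b \<union> {u}" "T = intro_vertex_set D k u S" "u \<in> label_set k - b"
    | u where "c = b - {u}" "T = forget_vertex_set D k u S" "u \<in> b"
    | u v where "c = b" "T = intro_edge_set D k u v S" "u \<in> b" "v \<in> b" "u \<noteq> v"
    using assms(2) unfolding X Z unary_successors_def by auto
  then show ?thesis
  proof cases
    case 1
    then obtain u' where u': "u' \<in> label_set k" "f u = Some u'" using val by blast
    have "map_image f c = map_image f b \<union> {u'}" "u' \<notin> map_image f b"
      using 1 u' inj by (auto simp: map_image_def)
    moreover have "act_set \<rho> k f T = intro_vertex_set D k u' (act_set \<rho> k f S)"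
      using tr(1)[OF u'(2)] 1(2) lbl(2) by simp
    ultimately show ?thesis
      using unary_successorsI(1)[of u' k "map_image f b"] u'(1) by (simp add: X Z relabel_state_def)
  next
    case 2
    then obtain u' where u': "u' \<in> label_set k" "f u = Some u'" using val wf(1) by blast
    have "map_image f c = map_image f b - {u'}" "u' \<in> map_image f b"
      using 2 u' inj by (auto simp: map_image_def)
    moreover have "act_set \<rho> k f T = forget_vertex_set D k u' (act_set \<rho> k f S)"
      using tr(2)[OF u'(2)] 2(2) lbl(2) by simp
    ultimately show ?thesis
      using unary_successorsI(2)[of u' "map_image f b"] by (simp add: X Z relabel_state_def)
  next
    case 3
    then obtain u' v' where u': "f u = Some u'" "f v = Some v'" using val wf(1) by blast
    have "u' \<in> map_image f b" "v' \<in> map_image f b" "u' \<noteq> v'"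
      using 3 u' inj by (auto simp: map_image_def)
    moreover have "act_set \<rho> k f T = intro_edge_set D k u' v' (act_set \<rho> k f S)"
      using tr(3)[OF u'(1)] u'(2) 3(2,5) lbl(2) by simp
    ultimately show ?thesis
      using unary_successorsI(3)[of u' "map_image f b" v'] 3(1) by (simp add: X Z relabel_state_def)
  qed
qed

text \<open>For completeness of the search: expanding a canonical representative loses no successor
  up to relabeling.\<close>

lemma unary_successor_of_relabeled:
  assumes "well_formed D Lbl k X" and "Z \<in> unary_successors D k X" and "Y \<in> relabeled_states \<rho> k X"
  shows "\<exists>Z'\<in>unary_successors D k Y. Z' \<in> relabeled_states \<rho> k Z"
proof -
  obtain f where f: "f \<in> relabelings k" "dom f = label_set k" "Y = relabel_state \<rho> k f X"
    using relabeled_states_full[OF assms(1,3)] .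
  have wfZ: "well_formed D Lbl k Z" using well_formed_unary assms by blast
  then have "relabel_state \<rho> k f Z \<in> relabeled_states \<rho> k Z"
    using relabel_state_in_relabeled_states f well_formedD(1) by (metis prod.collapse)
  then show ?thesis using relabel_unary_successor[OF assms(1,2) f(1,2)] f(3) by blast
qed

text \<open>The commuting square read backwards: a relabeling of the successor, extended to all
  labels, is applied to the predecessor. This lifts relabelings through terms.\<close>

lemma relabeled_of_unary_successor:
  assumes "well_formed D Lbl k X" and "Z \<in> unary_successors D k X" and "Z' \<in> relabeled_states \<rho> k Z"
  shows "\<exists>Y\<in>relabeled_states \<rho> k X. Z' \<in> unary_successors D k Y"
proof -
  have wfZ: "well_formed D Lbl k Z" using well_formed_unary assms by blast
  obtain f where f: "f \<in> relabelings k" "dom f = label_set k" "Z' = relabel_state \<rho> k f Z"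
    using relabeled_states_full[OF wfZ assms(3)] .
  have "relabel_state \<rho> k f X \<in> relabeled_states \<rho> k X"
    using relabel_state_in_relabeled_states f well_formedD(1) assms(1) by (metis prod.collapse)
  then show ?thesis using relabel_unary_successor[OF assms(1,2) f(1,2)] f(3) by blast
qed

text \<open>A join keeps the bag, so a relabeling of the bag alone covers all labels
  involved.\<close>

lemma relabel_join:
  assumes "well_formed D Lbl k (b, S)" and "well_formed D Lbl k (b, S')"
    and "f \<in> relabelings k" and "dom f = b"
  shows "relabel_state \<rho> k f (b, join_set D k S S') =
    (map_image f b, join_set D k (act_set \<rho> k f S) (act_set \<rho> k f S'))"
  using act_set_join[OF assms(3), unfolded assms(4), OF well_formedD(4,3)[OF assms(1)]
      well_formedD(4,3)[OF assms(2)] well_formedD(3)[OF well_formed_join_set[OF assms(1,2)]]]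
  by (simp add: relabel_state_def)

lemma join_successor_of_relabeled:
  assumes wf: "well_formed D Lbl k (b, S)" "well_formed D Lbl k (b, S')"
    and "Y \<in> relabeled_states \<rho> k (b, S)" and "Y' \<in> relabeled_states \<rho> k (b, S')"
    and bags: "fst Y = fst Y'"
  shows "\<exists>Z\<in>join_successors D \<rho> k Y Y'. Z \<in> relabeled_states \<rho> k (b, join_set D k S S')"
proof -
  obtain f where f: "f \<in> relabelings k" "dom f = b" "Y = (map_image f b, act_set \<rho> k f S)"
    using assms(3) by (auto elim!: relabeled_statesE simp: relabel_state_def)
  obtain g where g: "g \<in> relabelings k" "dom g = b" "Y' = (map_image g b, act_set \<rho> k g S')"
    using assms(4) by (auto elim!: relabeled_statesE simp: relabel_state_def)
  have ran: "ran f = ran g" "map_image f b = ran f" "map_image g b = ran f"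
    using bags f g by (auto simp: map_image_dom)
  \<comment> \<open>\<open>\<pi>\<close> undoes \<open>g\<close> and then applies \<open>f\<close>.
    As \<open>f\<close> and \<open>g\<close> have the same range, it permutes the common bag; it
    turns the second argument into its relabeling by \<open>f\<close>, so the join becomes the
    relabeling of the original join by \<open>f\<close>.\<close>
  define \<pi> where "\<pi> = f \<circ>\<^sub>m map_inverse g"
  note inv = map_inverse_eq_Some[OF relabelingsD(3)[OF g(1)]]
  have \<pi>: "\<pi> \<in> relabelings k"
    unfolding \<pi>_def by (intro map_comp_relabeling map_inverse_relabeling f g)
  have "\<pi> x = Some y \<longleftrightarrow> (\<exists>a. g a = Some x \<and> f a = Some y)" for x y
    by (auto simp: \<pi>_def map_comp_Some_iff inv)
  note \<pi>_iff = this
  have dr: "dom \<pi> = ran f" "ran \<pi> = ran f"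
  proof -
    have "dom \<pi> = ran g"
    proof (intro equalityI subsetI)
      fix x assume "x \<in> ran g"
      then obtain a where a: "g a = Some x" by (auto simp: ran_def)
      then obtain y where "f a = Some y" using f(2) g(2) by blast
      with a show "x \<in> dom \<pi>" using \<pi>_iff by blast
    qed (use \<pi>_iff in \<open>auto intro: ranI\<close>)
    then show "dom \<pi> = ran f" using ran by simp
    show "ran \<pi> = ran f"
    proof (intro equalityI subsetI)
      fix y assume "y \<in> ran f"
      then obtain a where a: "f a = Some y" by (auto simp: ran_def)
      then obtain x where "g a = Some x" using f(2) g(2) by blast
      with a show "y \<in> ran \<pi>" using \<pi>_iff by (auto intro: ranI)
    qed (use \<pi>_iff in \<open>auto simp: ran_def\<close>)
  qed
  have "\<pi> \<circ>\<^sub>m g = f"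
  proof
    fix a show "(\<pi> \<circ>\<^sub>m g) a = f a"
    proof (cases "a \<in> b")
      case True
      then obtain x y where "g a = Some x" "f a = Some y" using f(2) g(2) by blast
      then show ?thesis using \<pi>_iff by auto
    next
      case False
      then have "g a = None" "f a = None" using f(2) g(2) by auto
      then show ?thesis by (simp add: map_comp_def)
    qed
  qed
  then have act: "act_set \<rho> k \<pi> (act_set \<rho> k g S') = act_set \<rho> k f S'"
    using act_set_comp[OF \<pi> g(1), of S'] well_formedD(4)[OF wf(2)] by simp
  let ?Z = "relabel_state \<rho> k f (b, join_set D k S S')"
  have "?Z = (ran f, join_set D k (act_set \<rho> k f S) (act_set \<rho> k \<pi> (act_set \<rho> k g S')))"
    using relabel_join[OF wf f(1,2)] act ran by simp
  then have "?Z \<in> join_successors D \<rho> k Y Y'"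
    using \<pi> dr unfolding f(3) g(3) ran join_successors_def by auto
  moreover have "?Z \<in> relabeled_states \<rho> k (b, join_set D k S S')"
    using f(1,2) by (auto simp: relabeled_states_def)
  ultimately show ?thesis by blast
qed

text \<open>Hides the permutation: the permuted second argument is itself a relabeled state with the
  same bag, so facts about classes apply to it.\<close>

lemma join_successorsE:
  assumes "well_formed D Lbl k X'" and "Z \<in> join_successors D \<rho> k X X'"
  obtains b S S' where "X = (b, S)" and "(b, S') \<in> relabeled_states \<rho> k X'"
    and "Z = (b, join_set D k S S')"
proof -
  obtain b S S0 \<pi> where *: "X = (b, S)" "X' = (b, S0)" "\<pi> \<in> relabelings k" "dom \<pi> = b" "ran \<pi> = b"
      "Z = (b, join_set D k S (act_set \<rho> k \<pi> S0))"
    using assms(2) by (auto simp: join_successors_def split: prod.splits)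
  then have "(b, act_set \<rho> k \<pi> S0) = relabel_state \<rho> k \<pi> X'"
    by (simp add: relabel_state_def map_image_dom)
  then have "(b, act_set \<rho> k \<pi> S0) \<in> relabeled_states \<rho> k X'"
    using * unfolding relabeled_states_def by auto
  then show ?thesis using * that by blast
qed

text \<open>An empty bag admits only the empty relabeling, which fixes the label-free leaf witnesses
  by \<open>action_empty\<close>. Hence the search starts at the initial state itself, and the
  induction over terms has its base case.\<close>

lemma relabeled_initial: "relabeled_states \<rho> k (initial_state D k) = {initial_state D k}"
proof -
  have e: "Map.empty \<in> relabelings k" by (simp add: relabelings_def)
  have l: "leafs D k \<subseteq> wits D k" "\<And>w. w \<in> leafs D k \<Longrightarrow> Lbl k w = {}"
    using well_formedD[OF well_formed_initial[unfolded initial_state_def]]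
    by (auto simp: Lbl_set_def)
  have "act_set \<rho> k Map.empty (leafs D k) = leafs D k"
    using action_empty l by (auto simp: act_set_def map_image_def subset_iff)
  then have "relabel_state \<rho> k Map.empty (initial_state D k) = initial_state D k"
    by (simp add: relabel_state_def initial_state_def map_image_def)
  then show ?thesis
    using e by (auto simp: relabeled_states_def initial_state_def intro!: exI[of _ Map.empty])
qed

section \<open>Realizable states\<close>

text \<open>The invariant behind soundness: an inconsistent state refutes inclusion only if it is
  the state of an actual term.\<close>

definition realized :: "state \<Rightarrow> bool" where
  "realized X \<longleftrightarrow> (\<exists>\<tau>. legal k \<tau> \<and> X = (bag \<tau>, dyn D k \<tau>))"

text \<open>\<open>clean\<close> is known to be the identity only on finite sets of witnesses, hence
  the well-formedness assumptions. Later proofs delete \<open>dyn.simps\<close> so that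
  \<open>clean\<close> does not come back.\<close>

lemma dyn_simps:
  assumes "well_formed D Lbl k (bag \<tau>, dyn D k \<tau>)"
  shows "u \<in> label_set k \<Longrightarrow> dyn D k (IntroVertex u \<tau>) = intro_vertex_set D k u (dyn D k \<tau>)"
    and "u \<in> label_set k \<Longrightarrow> dyn D k (ForgetVertex u \<tau>) = forget_vertex_set D k u (dyn D k \<tau>)"
    and "u \<in> label_set k \<Longrightarrow> v \<in> label_set k \<Longrightarrow> u \<noteq> v \<Longrightarrow>
      dyn D k (IntroEdge u v \<tau>) = intro_edge_set D k u v (dyn D k \<tau>)"
    and "well_formed D Lbl k (bag \<sigma>, dyn D k \<sigma>) \<Longrightarrow>
      dyn D k (Join \<sigma> \<tau>) = join_set D k (dyn D k \<sigma>) (dyn D k \<tau>)"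
  using cleaning[unfolded identity_cleaning_def, THEN spec[of _ k]] well_formedD(2)[of "bag \<sigma>" "dyn D k \<sigma>"]
    transitions_fin(1-3)[OF well_formedD(2)[OF assms]] transitions_fin(4)[OF _ well_formedD(2)[OF assms]]
  by simp_all

text \<open>The three unary constructors are bundled so that inductions over terms can treat them by
  one argument.\<close>

lemma unary_successor_term:
  assumes "well_formed D Lbl k (bag \<tau>, dyn D k \<tau>)" and "\<tau>' \<in> {IntroVertex u \<tau>, ForgetVertex u \<tau>, IntroEdge u v \<tau>}"
    and "legal k \<tau>'"
  shows "(bag \<tau>', dyn D k \<tau>') \<in> unary_successors D k (bag \<tau>, dyn D k \<tau>)"
proof -
  consider "\<tau>' = IntroVertex u \<tau>" | "\<tau>' = ForgetVertex u \<tau>" | "\<tau>' = IntroEdge u v \<tau>"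
    using assms(2) by blast
  then show ?thesis
  proof cases
    case 1
    then show ?thesis
      using assms(3) dyn_simps(1)[OF assms(1), of u] unary_successorsI(1)[of u k "bag \<tau>"]
      by (simp del: dyn.simps)
  next
    case 2
    then show ?thesis
      using assms(3) dyn_simps(2)[OF assms(1), of u] unary_successorsI(2)[of u "bag \<tau>"]
      by (simp del: dyn.simps)
  next
    case 3
    then show ?thesis
      using assms(3) dyn_simps(3)[OF assms(1), of u v] unary_successorsI(3)[of u "bag \<tau>" v]
      by (simp del: dyn.simps)
  qed
qed

lemma well_formed_term: "legal k \<tau> \<Longrightarrow> well_formed D Lbl k (bag \<tau>, dyn D k \<tau>)"
proof (induction \<tau>)
  case Leaf
  then show ?case using well_formed_initial by (simp add: initial_state_def)
next
  case (IntroVertex u \<tau>)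
  then have "well_formed D Lbl k (bag \<tau>, dyn D k \<tau>)" by simp
  from well_formed_unary[OF this unary_successor_term[OF this _ IntroVertex.prems, of u]]
  show ?case by simp
next
  case (ForgetVertex u \<tau>)
  then have "well_formed D Lbl k (bag \<tau>, dyn D k \<tau>)" by simp
  from well_formed_unary[OF this unary_successor_term[OF this _ ForgetVertex.prems, of u]]
  show ?case by simp
next
  case (IntroEdge u v \<tau>)
  then have "well_formed D Lbl k (bag \<tau>, dyn D k \<tau>)" by simp
  from well_formed_unary[OF this unary_successor_term[OF this _ IntroEdge.prems, of u v]]
  show ?case by simp
next
  case (Join \<sigma> \<tau>)
  then have "well_formed D Lbl k (bag \<sigma>, dyn D k \<sigma>)" "well_formed D Lbl k (bag \<tau>, dyn D k \<tau>)"
    and "bag \<sigma> = bag \<tau>" by auto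
  then show ?case using dyn_simps(4) well_formed_join_set by (metis bag.simps(5))
qed

lemma realized_well_formed: "realized X \<Longrightarrow> well_formed D Lbl k X"
  using well_formed_term by (auto simp: realized_def)

lemma realized_initial: "realized (initial_state D k)"
  unfolding realized_def initial_state_def by (intro exI[of _ Leaf]) simp

lemma realized_unary:
  assumes "realized X" and "Z \<in> unary_successors D k X"
  shows "realized Z"
proof -
  obtain \<tau> where \<tau>: "legal k \<tau>" "X = (bag \<tau>, dyn D k \<tau>)" using assms(1) by (auto simp: realized_def)
  note wf = well_formed_term[OF \<tau>(1)]
  have b: "bag \<tau> \<subseteq> label_set k" using well_formedD(1)[OF wf] .
  consider u where "Z = (bag \<tau> \<union> {u}, intro_vertex_set D k u (dyn D k \<tau>))" "u \<in> label_set k - bag \<tau>"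
    | u where "Z = (bag \<tau> - {u}, forget_vertex_set D k u (dyn D k \<tau>))" "u \<in> bag \<tau>"
    | u v where "Z = (bag \<tau>, intro_edge_set D k u v (dyn D k \<tau>))" "u \<in> bag \<tau>" "v \<in> bag \<tau>" "u \<noteq> v"
    using assms(2) unfolding \<tau>(2) unary_successors_def by auto
  then show ?thesis
  proof cases
    case 1
    then show ?thesis using \<tau>(1) dyn_simps(1)[OF wf, of u] unfolding realized_def
      by (intro exI[of _ "IntroVertex u \<tau>"]) (simp del: dyn.simps)
  next
    case 2
    then have "u \<in> label_set k" using b by blast
    with 2 show ?thesis using \<tau>(1) dyn_simps(2)[OF wf, of u] unfolding realized_def
      by (intro exI[of _ "ForgetVertex u \<tau>"]) (simp del: dyn.simps)
  next
    case 3
    then have "u \<in> label_set k" "v \<in> label_set k" using b by blast+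
    with 3 show ?thesis using \<tau>(1) dyn_simps(3)[OF wf, of u v] unfolding realized_def
      by (intro exI[of _ "IntroEdge u v \<tau>"]) (simp del: dyn.simps)
  qed
qed

lemma realized_join_set:
  assumes "realized (b, S)" and "realized (b, S')"
  shows "realized (b, join_set D k S S')"
proof -
  obtain \<sigma> \<tau> where *: "legal k \<sigma>" "legal k \<tau>" "b = bag \<sigma>" "b = bag \<tau>" "S = dyn D k \<sigma>" "S' = dyn D k \<tau>"
    using assms by (auto simp: realized_def)
  then have "dyn D k (Join \<sigma> \<tau>) = join_set D k S S'" using dyn_simps(4) well_formed_term by metis
  with * show ?thesis
    unfolding realized_def by (intro exI[of _ "Join \<sigma> \<tau>"]) (simp del: dyn.simps)
qed

lemma realized_relabeled_unary:
  assumes "legal k \<tau>" and "\<And>Y. Y \<in> relabeled_states \<rho> k (bag \<tau>, dyn D k \<tau>) \<Longrightarrow> realized Y"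
    and "\<tau>' \<in> {IntroVertex u \<tau>, ForgetVertex u \<tau>, IntroEdge u v \<tau>}" and "legal k \<tau>'"
    and "Z \<in> relabeled_states \<rho> k (bag \<tau>', dyn D k \<tau>')"
  shows "realized Z"
proof -
  note wf = well_formed_term[OF assms(1)]
  obtain Y where "Y \<in> relabeled_states \<rho> k (bag \<tau>, dyn D k \<tau>)" "Z \<in> unary_successors D k Y"
    using relabeled_of_unary_successor[OF wf unary_successor_term[OF wf assms(3,4)] assms(5)] by blast
  then show ?thesis using assms(2) realized_unary by blast
qed

text \<open>The relabeling is pushed down to the subterms and the realizing term is rebuilt on the
  way up. \<open>Y\<close> is general because the relabeling of a subterm is an extension or
  restriction of the given one.\<close>

lemma realized_relabeled_term:
  "legal k \<tau> \<Longrightarrow> Y \<in> relabeled_states \<rho> k (bag \<tau>, dyn D k \<tau>) \<Longrightarrow> realized Y"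
proof (induction \<tau> arbitrary: Y)
  case Leaf
  then show ?case using relabeled_initial realized_initial by (simp add: initial_state_def)
next
  case (IntroVertex u \<tau>)
  then show ?case using realized_relabeled_unary[of \<tau> "IntroVertex u \<tau>"] by simp
next
  case (ForgetVertex u \<tau>)
  then show ?case using realized_relabeled_unary[of \<tau> "ForgetVertex u \<tau>"] by simp
next
  case (IntroEdge u v \<tau>)
  then show ?case using realized_relabeled_unary[of \<tau> "IntroEdge u v \<tau>"] by simp
next
  case (Join \<sigma> \<tau>)
  let ?b = "bag \<sigma>" and ?S = "dyn D k \<sigma>" and ?T = "dyn D k \<tau>"
  have l: "legal k \<sigma>" "legal k \<tau>" "bag \<tau> = ?b" using Join.prems(1) by auto
  note wf = well_formed_term[OF l(1)] well_formed_term[OF l(2), unfolded l(3)]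
  have "Y \<in> relabeled_states \<rho> k (?b, join_set D k ?S ?T)"
    using Join.prems(2) dyn_simps(4)[of \<tau> \<sigma>] wf l(3) by (simp del: dyn.simps)
  \<comment> \<open>The same \<open>f\<close> relabels both children, so their bags still agree and
    the rebuilt join is legal.\<close>
  then obtain f where f: "f \<in> relabelings k" "dom f = ?b"
      "Y = (map_image f ?b, join_set D k (act_set \<rho> k f ?S) (act_set \<rho> k f ?T))"
    using relabel_join[OF wf] by (auto elim!: relabeled_statesE)
  have "relabel_state \<rho> k f (?b, ?S) \<in> relabeled_states \<rho> k (?b, ?S)"
    "relabel_state \<rho> k f (?b, ?T) \<in> relabeled_states \<rho> k (?b, ?T)"
    using f by (auto simp: relabeled_states_def)
  then have "realized (map_image f ?b, act_set \<rho> k f ?S)" "realized (map_image f ?b, act_set \<rho> k f ?T)"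
    using Join.IH l by (auto simp: relabel_state_def)
  then show ?case unfolding f(3) by (rule realized_join_set)
qed

lemma realized_relabeled:
  assumes "realized X" and "Y \<in> relabeled_states \<rho> k X"
  shows "realized Y"
proof -
  obtain \<tau> where "legal k \<tau>" "X = (bag \<tau>, dyn D k \<tau>)"
    using assms(1) unfolding realized_def by blast
  then show ?thesis using realized_relabeled_term assms(2) by blast
qed

text \<open>The join rule permutes one argument; this is where closure of realizability under
  relabeling enters the search.\<close>

lemma realized_join:
  assumes "realized X" and "realized X'" and "Z \<in> join_successors D \<rho> k X X'"
  shows "realized Z"
  using assms(3)
proof (rule join_successorsE[OF realized_well_formed[OF assms(2)]])
  fix b S S' assume "X = (b, S)" "(b, S') \<in> relabeled_states \<rho> k X'" "Z = (b, join_set D k S S')"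
  then show ?thesis using realized_join_set realized_relabeled[OF assms(2)] assms(1) by simp
qed

end

section \<open>Canonization\<close>

locale relabeled_test = relabeled_core +
  fixes r :: "witness rel" and enum :: "state list \<Rightarrow> state set \<Rightarrow> state list"
  assumes finite_wits: "finite (wits D k)"
    and linear: "linear_order_on (wits D k) r"
    and set_enum: "\<And>R X. finite X \<Longrightarrow> set (enum R X) = X"
begin

abbreviation can :: "state \<Rightarrow> state" where
  "can \<equiv> CAN \<rho> r k"

text \<open>Serves three purposes: least relabelings exist, successor sets are finite, and the
  search stops.\<close>

lemma finite_well_formed: "finite {X. well_formed D Lbl k X}"
proof (rule finite_subset)
  show "{X. well_formed D Lbl k X} \<subseteq> Pow (label_set k) \<times> Pow (wits D k)"
    by (auto simp: well_formed_def fin_subsets_def)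
qed (simp add: finite_wits)

lemma relabeled_states_nonempty:
  assumes "well_formed D Lbl k X"
  shows "relabeled_states \<rho> k X \<noteq> {}"
proof -
  let ?f = "Some |` fst X"
  have d: "dom ?f = fst X" by (auto simp: restrict_map_def dom_def)
  have "fst X \<subseteq> label_set k" using well_formedD(1) assms by (metis prod.collapse)
  moreover have "ran ?f = fst X" by (auto simp: restrict_map_def ran_def)
  moreover have "inj_on ?f (dom ?f)" using d by (auto simp: inj_on_def)
  ultimately have "?f \<in> relabelings k" using d by (simp add: relabelings_def)
  then show ?thesis using d unfolding relabeled_states_def by blast
qed

lemma CAN_least:
  assumes "well_formed D Lbl k X"
  shows "can X \<in> relabeled_states \<rho> k X"
    and "Z \<in> relabeled_states \<rho> k X \<Longrightarrow> Z = can X \<or> (can X, Z) \<in> state_less r"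
proof -
  let ?A = "relabeled_states \<rho> k X"
  let ?P = "\<lambda>Y. Y \<in> ?A \<and> (\<forall>Z\<in>?A. Z = Y \<or> (Y, Z) \<in> state_less r)"
  have wf: "?A \<subseteq> {X. well_formed D Lbl k X}" using well_formed_relabeled[OF assms] by blast
  have "\<exists>Y\<in>?A. \<forall>Z\<in>?A. Z \<noteq> Y \<longrightarrow> (Y, Z) \<in> state_less r"
  proof (rule Finite_Set.bex_least_element)
    show "finite ?A" using wf finite_well_formed by (rule finite_subset)
    show "?A \<noteq> {}" using relabeled_states_nonempty[OF assms] .
    show "transp_on ?A (\<lambda>x y. (x, y) \<in> state_less r)"
      unfolding transp_on_def using state_less_trans[OF linear] by blast
    show "totalp_on ?A (\<lambda>x y. (x, y) \<in> state_less r)"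
    proof (rule totalp_onI)
      fix U V assume UV: "U \<in> ?A" "V \<in> ?A" "U \<noteq> V"
      obtain b S b' S' where eq: "U = (b, S)" "V = (b', S')" by fastforce
      have wfU: "well_formed D Lbl k (b, S)" and wfV: "well_formed D Lbl k (b', S')"
        using UV wf eq by auto
      have "finite b" "finite b'"
        using well_formedD(1)[OF wfU] well_formedD(1)[OF wfV] by (auto intro: finite_subset)
      then show "(U, V) \<in> state_less r \<or> (V, U) \<in> state_less r"
        using state_less_total[OF linear _ _ well_formedD(2)[OF wfU] well_formedD(2)[OF wfV]] UV(3) eq
        by blast
    qed
  qed
  then obtain Y where Y: "?P Y" by blast
  have "can X = Y"
    unfolding CAN_def
  proof (rule the_equality)
    fix Y' assume Y': "?P Y'"
    show "Y' = Y"
    proof (rule ccontr)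
      assume "Y' \<noteq> Y"
      then have "(Y, Y') \<in> state_less r" "(Y', Y) \<in> state_less r"
        using Y Y' by metis+
      then show False using state_less_trans[OF linear] state_less_irrefl by blast
    qed
  qed (fact Y)
  then show "can X \<in> ?A" and "Z \<in> ?A \<Longrightarrow> Z = can X \<or> (can X, Z) \<in> state_less r"
    using Y by blast+
qed

lemma CAN_relabeled:
  assumes "well_formed D Lbl k X" and "Y \<in> relabeled_states \<rho> k X"
  shows "can Y = can X"
  unfolding CAN_def relabeled_states_eq[OF assms] ..

lemma canonical_CAN: "well_formed D Lbl k X \<Longrightarrow> canonical \<rho> r k (can X)"
  using CAN_relabeled CAN_least(1) by (simp add: canonical_def)

lemma realized_CAN: "realized X \<Longrightarrow> realized (can X)"
  using realized_relabeled CAN_least(1) realized_well_formed by blast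

lemma CAN_initial: "can (initial_state D k) = initial_state D k"
  using CAN_least(1)[OF well_formed_initial] relabeled_initial by simp

text \<open>The bag is compared first, so the canonical bag does not depend on the witness set; this is
  what makes joins of canonical states possible.\<close>

lemma CAN_bag:
  assumes "well_formed D Lbl k (b, S)" and "well_formed D Lbl k (b, S')"
  shows "fst (can (b, S)) = fst (can (b, S'))"
proof -
  let ?l = "\<lambda>X. sorted_list_of_set (fst X) :: nat list"
  have le: "?l (can (b, S)) = ?l (can (b, S')) \<or> (?l (can (b, S)), ?l (can (b, S'))) \<in> lexord less_than"
    if S: "well_formed D Lbl k (b, S)" and S': "well_formed D Lbl k (b, S')" for S S'
  proof -
    \<comment> \<open>The relabeling chosen for \<open>S'\<close> also competes for
      \<open>S\<close>, with the bag of \<open>can (b, S')\<close>. Exchanging the two sets gives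
      the reverse comparison, and asymmetry then forces equality.\<close>
    obtain f where f: "f \<in> relabelings k" "dom f = b" "can (b, S') = relabel_state \<rho> k f (b, S')"
      using relabeled_statesE[OF CAN_least(1)[OF S']] by auto
    then have "relabel_state \<rho> k f (b, S) \<in> relabeled_states \<rho> k (b, S)"
      unfolding relabeled_states_def by auto
    from CAN_least(2)[OF S this]
    have "?l (can (b, S)) = ?l (relabel_state \<rho> k f (b, S)) \<or>
        (?l (can (b, S)), ?l (relabel_state \<rho> k f (b, S))) \<in> lexord less_than"
      by (auto simp: state_less_def split: prod.splits)
    moreover have "fst (relabel_state \<rho> k f (b, S)) = fst (can (b, S'))"
      using f(3) by (simp add: relabel_state_def)
    ultimately show ?thesis by simp
  qed
  have "asym (lexord less_than)" by (intro lexord_asym) (auto intro: asymI)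
  then have "?l (can (b, S)) = ?l (can (b, S'))"
    using le[OF assms] le[OF assms(2,1)] by (auto dest: asymD)
  moreover have "finite (fst (can (b, T)))" if "well_formed D Lbl k (b, T)" for T
    using well_formedD(1) well_formed_relabeled[OF that CAN_least(1)[OF that]]
    by (metis finite_atLeastAtMost finite_subset prod.collapse)
  ultimately show ?thesis using assms by (metis set_sorted_list_of_set)
qed

section \<open>The search\<close>

definition derived :: "state set \<Rightarrow> state set" where
  "derived C = (\<Union>X\<in>C. unary_successors D k X) \<union> (\<Union>X\<in>C. \<Union>X'\<in>C. join_successors D \<rho> k X X')"

text \<open>The join pairs added by \<open>X\<close> are those that involve \<open>X\<close>. Hence
  the test tries both argument orders, and it appends \<open>X\<close> to the list before generating
  successors so that \<open>X\<close> is also joined with itself.\<close>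

lemma derived_snoc: "derived (set (R @ [X])) = derived (set R) \<union> successors D \<rho> k (R @ [X]) X"
  by (auto simp: derived_def successors_def)

lemma realized_derived: "(\<And>X. X \<in> C \<Longrightarrow> realized X) \<Longrightarrow> Z \<in> derived C \<Longrightarrow> realized Z"
  unfolding derived_def using realized_unary realized_join by blast

lemma closed_contains_terms:
  assumes init: "initial_state D k \<in> C" and closed: "can ` derived C \<subseteq> C"
  shows "legal k \<tau> \<Longrightarrow> can (bag \<tau>, dyn D k \<tau>) \<in> C"
proof (induction \<tau>)
  have unary: "can (bag \<tau>', dyn D k \<tau>') \<in> C"
    if prems: "legal k \<tau>" "legal k \<tau>'" "can (bag \<tau>, dyn D k \<tau>) \<in> C"
      "\<tau>' \<in> {IntroVertex u \<tau>, ForgetVertex u \<tau>, IntroEdge u v \<tau>}" for \<tau> \<tau>' u v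
  proof -
    let ?X = "(bag \<tau>, dyn D k \<tau>)" and ?Z = "(bag \<tau>', dyn D k \<tau>')"
    note wf = well_formed_term[OF prems(1)]
    obtain Z' where Z': "Z' \<in> unary_successors D k (can ?X)" "Z' \<in> relabeled_states \<rho> k ?Z"
      using unary_successor_of_relabeled[OF wf unary_successor_term[OF wf prems(4,2)] CAN_least(1)[OF wf]]
      by blast
    then have "can Z' \<in> C" using closed prems(3) unfolding derived_def by blast
    then show ?thesis using CAN_relabeled[OF well_formed_term[OF prems(2)] Z'(2)] by simp
  qed
  {
    case Leaf
    then show ?case using init CAN_initial by (simp add: initial_state_def)
  next
    case (IntroVertex u \<tau>)
    then show ?case by (intro unary[of \<tau> "IntroVertex u \<tau>" u]) auto
  next
    case (ForgetVertex u \<tau>)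
    then show ?case by (intro unary[of \<tau> "ForgetVertex u \<tau>" u]) auto
  next
    case (IntroEdge u v \<tau>)
    then show ?case by (intro unary[of \<tau> "IntroEdge u v \<tau>" u v]) auto
  next
    case (Join \<sigma> \<tau>)
    let ?b = "bag \<sigma>" and ?S = "dyn D k \<sigma>" and ?T = "dyn D k \<tau>"
    have l: "legal k \<sigma>" "legal k \<tau>" "bag \<tau> = ?b" using Join.prems by auto
    note wf = well_formed_term[OF l(1)] well_formed_term[OF l(2), unfolded l(3)]
    obtain Z where Z: "Z \<in> join_successors D \<rho> k (can (?b, ?S)) (can (?b, ?T))"
        "Z \<in> relabeled_states \<rho> k (?b, join_set D k ?S ?T)"
      using join_successor_of_relabeled[OF wf CAN_least(1)[OF wf(1)] CAN_least(1)[OF wf(2)] CAN_bag[OF wf]]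
      by blast
    have "can (?b, ?S) \<in> C" "can (?b, ?T) \<in> C" using Join.IH l by simp_all
    then have "can Z \<in> C" using Z(1) closed unfolding derived_def by blast
    moreover have "can Z = can (?b, join_set D k ?S ?T)"
      using CAN_relabeled[OF well_formed_join_set[OF wf] Z(2)] .
    moreover have "dyn D k (Join \<sigma> \<tau>) = join_set D k ?S ?T"
      using dyn_simps(4)[of \<tau> \<sigma>] wf l(3) by (simp del: dyn.simps)
    ultimately show ?case by (simp del: dyn.simps)
  }
qed

text \<open>The derivability clause of \<open>canonized_refutation\<close>, isolated because it
  survives both truncation and extension of the list.\<close>

definition derivation :: "state list \<Rightarrow> bool" where
  "derivation L \<longleftrightarrow> (\<forall>i. 1 \<le> i \<and> i < length L \<longrightarrow>
     (\<exists>j<i. \<exists>X \<in> unary_successors D k (L ! j) \<union> (\<Union>l<i. join_successors D \<rho> k (L ! j) (L ! l)).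
        L ! i \<in> relabeled_states \<rho> k X))"

text \<open>The justification of entry \<open>i\<close> looks only at indices below
  \<open>i\<close>.\<close>

lemma derivation_append_left:
  assumes "derivation (L @ N)"
  shows "derivation L"
  unfolding derivation_def
proof (intro allI impI)
  fix i assume i: "1 \<le> i \<and> i < length L"
  then obtain j X where j: "j < i" "(L @ N) ! i \<in> relabeled_states \<rho> k X"
      "X \<in> unary_successors D k ((L @ N) ! j) \<union> (\<Union>l<i. join_successors D \<rho> k ((L @ N) ! j) ((L @ N) ! l))"
    using assms[unfolded derivation_def, THEN spec[of _ i]] by auto
  have nth: "(L @ N) ! l = L ! l" if "l \<le> i" for l using that i by (simp add: nth_append)
  have "(\<Union>l<i. join_successors D \<rho> k ((L @ N) ! j) ((L @ N) ! l)) =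
      (\<Union>l<i. join_successors D \<rho> k (L ! j) (L ! l))"
    using nth j(1) by (intro SUP_cong) auto
  then show "\<exists>j<i. \<exists>X \<in> unary_successors D k (L ! j) \<union> (\<Union>l<i. join_successors D \<rho> k (L ! j) (L ! l)).
        L ! i \<in> relabeled_states \<rho> k X"
    using j nth[of i] nth[of j] by (metis order_refl less_imp_le)
qed

text \<open>Every entry of \<open>N\<close> cites parents in \<open>R\<close> only, and these occur
  in \<open>L\<close>, hence before all of \<open>N\<close>. Entries of \<open>N\<close> never cite
  each other.\<close>

lemma derivation_append:
  assumes "derivation L" and "set R \<subseteq> set L"
    and "\<And>Y. Y \<in> set N \<Longrightarrow> \<exists>X\<in>derived (set R). Y \<in> relabeled_states \<rho> k X"
  shows "derivation (L @ N)"
  unfolding derivation_def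
proof (intro allI impI)
  fix i assume i: "1 \<le> i \<and> i < length (L @ N)"
  let ?L = "L @ N"
  show "\<exists>j<i. \<exists>X \<in> unary_successors D k (?L ! j) \<union> (\<Union>l<i. join_successors D \<rho> k (?L ! j) (?L ! l)).
        ?L ! i \<in> relabeled_states \<rho> k X"
  proof (cases "i < length L")
    case True
    then obtain j X where j: "j < i" "L ! i \<in> relabeled_states \<rho> k X"
        "X \<in> unary_successors D k (L ! j) \<union> (\<Union>l<i. join_successors D \<rho> k (L ! j) (L ! l))"
      using assms(1)[unfolded derivation_def, THEN spec[of _ i]] i by auto
    have nth: "?L ! l = L ! l" if "l \<le> i" for l using that True by (simp add: nth_append)
    have "(\<Union>l<i. join_successors D \<rho> k (?L ! j) (?L ! l)) = (\<Union>l<i. join_successors D \<rho> k (L ! j) (L ! l))"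
      using nth j(1) by (intro SUP_cong) auto
    then show ?thesis using j nth[of i] nth[of j] by (metis order_refl less_imp_le)
  next
    case False
    then have "?L ! i \<in> set N" using i by (auto simp: nth_append)
    then obtain X where X: "X \<in> derived (set R)" "?L ! i \<in> relabeled_states \<rho> k X"
      using assms(3) by blast
    have idx: "\<exists>j<i. ?L ! j = V" if V: "V \<in> set R" for V
    proof -
      obtain j where "j < length L" "L ! j = V"
        using subsetD[OF assms(2) V] by (auto simp: in_set_conv_nth)
      then show ?thesis using False by (intro exI[of _ j]) (auto simp: nth_append)
    qed
    from X(1) consider V where "V \<in> set R" "X \<in> unary_successors D k V"
      | V V' where "V \<in> set R" "V' \<in> set R" "X \<in> join_successors D \<rho> k V V'"
      unfolding derived_def by blast
    then show ?thesis
    proof cases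
      case 1
      then show ?thesis using idx[OF 1(1)] X(2) by blast
    next
      case 2
      then show ?thesis using idx[OF 2(1)] idx[OF 2(2)] X(2) by blast
    qed
  qed
qed

text \<open>\<open>N\<close> is the list of newly discovered states. The properties depend on
  \<open>Zs\<close> only through its set, so order and repetitions in the enumeration are
  harmless.\<close>

lemma fold_enqueue:
  "\<exists>N. fold (enqueue \<rho> r k) Zs (Y, Seen) = (Y @ N, Seen \<union> set N) \<and> distinct N \<and>
    set N \<inter> Seen = {} \<and> set N \<subseteq> can ` set Zs \<and> can ` set Zs \<subseteq> Seen \<union> set N"
proof (induction Zs arbitrary: Y Seen)
  case (Cons Z Zs)
  show ?case
  proof (cases "can Z \<in> Seen")
    case True
    then have "enqueue \<rho> r k Z (Y, Seen) = (Y, Seen)" by (simp add: enqueue_def)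
    then show ?thesis using Cons.IH[of Y Seen] True by auto
  next
    case False
    have e: "enqueue \<rho> r k Z (Y, Seen) = (Y @ [can Z], insert (can Z) Seen)"
      using False by (simp add: enqueue_def Let_def)
    obtain N where N: "fold (enqueue \<rho> r k) Zs (Y @ [can Z], insert (can Z) Seen) =
        ((Y @ [can Z]) @ N, insert (can Z) Seen \<union> set N)" "distinct N"
      "set N \<inter> insert (can Z) Seen = {}" "set N \<subseteq> can ` set Zs"
      "can ` set Zs \<subseteq> insert (can Z) Seen \<union> set N"
      using Cons.IH[of "Y @ [can Z]" "insert (can Z) Seen"] by blast
    show ?thesis
      using N e False by (intro exI[of _ "can Z # N"]) auto
  qed
qed simp

text \<open>The derivation is claimed for \<open>R @ Y\<close>: a state is justified when it is
  enqueued, and removing the head of a FIFO queue to the end of \<open>R\<close> leaves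
  \<open>R @ Y\<close> unchanged. Closure is dropped once \<open>ret\<close> holds, since the last
  state is then returned without being expanded.\<close>

definition search_invariant :: "config \<Rightarrow> bool" where
  "search_invariant c \<longleftrightarrow> (case c of (R, Y, Seen, ret) \<Rightarrow>
     Seen = set (R @ Y) \<and> distinct (R @ Y) \<and>
     (\<forall>X\<in>Seen. realized X \<and> canonical \<rho> r k X) \<and>
     R @ Y \<noteq> [] \<and> hd (R @ Y) = initial_state D k \<and> derivation (R @ Y) \<and>
     (if ret then R \<noteq> [] \<and> inconsistent D k (last R)
      else (\<forall>X\<in>set R. \<not> inconsistent D k X) \<and> can ` derived (set R) \<subseteq> Seen))"

lemma search_invariant_init:
  "search_invariant ([], [initial_state D k], {initial_state D k}, False)"
  using realized_initial canonical_CAN[OF well_formed_initial] CAN_initial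
  by (simp add: search_invariant_def derivation_def derived_def)

lemma search_invariant_step:
  assumes "search_invariant (R, Y, Seen, False)" and "Y \<noteq> []"
  shows "search_invariant (test_step D \<rho> r enum k (R, Y, Seen, False))"
    and "length (fst (test_step D \<rho> r enum k (R, Y, Seen, False))) = Suc (length R)"
proof -
  obtain X Y' where Y: "Y = X # Y'" using assms(2) by (cases Y) auto
  let ?R = "R @ [X]"
  have inv: "Seen = set (?R @ Y')" "distinct (?R @ Y')" "\<forall>X\<in>Seen. realized X \<and> canonical \<rho> r k X"
    "hd (?R @ Y') = initial_state D k" "derivation (?R @ Y')" "\<forall>X\<in>set R. \<not> inconsistent D k X"
    "can ` derived (set R) \<subseteq> Seen"
    using assms(1) unfolding search_invariant_def Y by auto
  have real: "realized Z" if "Z \<in> derived (set ?R)" for Z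
    using realized_derived[OF _ that] inv(1,3) by auto
  let ?A = "successors D \<rho> k ?R X"
  have A: "?A \<subseteq> derived (set ?R)" unfolding derived_snoc by blast
  \<comment> \<open>Realizability places the successors among the finitely many well-formed states;
    \<open>enum\<close> is specified only for finite sets.\<close>
  have "finite ?A"
    using A real realized_well_formed by (intro finite_subset[OF _ finite_well_formed]) blast
  then have en: "set (enum ?R ?A) = ?A" by (rule set_enum)
  obtain N where N: "fold (enqueue \<rho> r k) (enum ?R ?A) (Y', Seen) = (Y' @ N, Seen \<union> set N)"
    "distinct N" "set N \<inter> Seen = {}" "set N \<subseteq> can ` ?A" "can ` ?A \<subseteq> Seen \<union> set N"
    using fold_enqueue[of "enum ?R ?A" Y' Seen] unfolding en by blast
  have step: "test_step D \<rho> r enum k (R, Y, Seen, False) =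
      (if inconsistent D k X then (?R, Y', Seen, True) else (?R, Y' @ N, Seen \<union> set N, False))"
    using N(1) by (simp add: test_step_def Y)
  then show "length (fst (test_step D \<rho> r enum k (R, Y, Seen, False))) = Suc (length R)" by simp
  show "search_invariant (test_step D \<rho> r enum k (R, Y, Seen, False))"
  proof (cases "inconsistent D k X")
    case True
    then show ?thesis using step inv by (simp add: search_invariant_def)
  next
    case False
    have realN: "realized Z \<and> canonical \<rho> r k Z" if "Z \<in> set N" for Z
    proof -
      obtain V where V: "V \<in> ?A" "Z = can V" using \<open>Z \<in> set N\<close> N(4) by blast
      have "realized V" using V(1) A real by blast
      then show ?thesis using V(2) realized_CAN canonical_CAN realized_well_formed by blast
    qed
    have "derivation ((?R @ Y') @ N)"
    proof (rule derivation_append[where R = ?R])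
      fix Z assume "Z \<in> set N"
      then obtain V where V: "V \<in> ?A" "Z = can V" using N(4) by blast
      then have "Z \<in> relabeled_states \<rho> k V" using CAN_least(1) A real realized_well_formed by blast
      then show "\<exists>X\<in>derived (set ?R). Z \<in> relabeled_states \<rho> k X" using V(1) A by blast
    qed (use inv(5) in auto)
    moreover have "hd ((?R @ Y') @ N) = initial_state D k" using inv(4) by (cases R) auto
    moreover have "distinct ((?R @ Y') @ N)"
      using inv(2) N(2,3) unfolding distinct_append[of "?R @ Y'"] inv(1) by blast
    moreover have "can ` derived (set ?R) \<subseteq> Seen \<union> set N"
      unfolding derived_snoc using inv(7) N(5) by blast
    moreover have "\<forall>V\<in>set ?R. \<not> inconsistent D k V" using inv(6) False by simp
    moreover have "\<forall>V\<in>Seen \<union> set N. realized V \<and> canonical \<rho> r k V" using inv(3) realN by blast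
    moreover have "Seen \<union> set N = set ((?R @ Y') @ N)" using inv(1) by auto
    ultimately have "search_invariant (?R, Y' @ N, Seen \<union> set N, False)"
      unfolding search_invariant_def by (simp only: prod.case append_assoc) simp
    then show ?thesis using step False by simp
  qed
qed

lemma search_terminates:
  obtains R Y Seen ret where
    "relabeled_inclusion_test D \<rho> r enum k = Some (if ret then Returned R else Inclusion_Holds)"
    and "search_invariant (R, Y, Seen, ret)" and "ret \<or> Y = []"
proof -
  let ?b = "\<lambda>(R, Y, Seen, ret). \<not> ret \<and> Y \<noteq> []" and ?c = "test_step D \<rho> r enum k"
  let ?s = "([], [initial_state D k], {initial_state D k}, False) :: config"
  let ?n = "card {X. well_formed D Lbl k X}"
  \<comment> \<open>A nonempty queue makes the bound strict, so the truncated subtraction in the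
    termination measure really decreases.\<close>
  have bound: "length R < ?n" if "search_invariant (R, Y, Seen, ret)" "Y \<noteq> []" for R Y Seen ret
  proof -
    have "distinct (R @ Y)" "set (R @ Y) \<subseteq> {X. well_formed D Lbl k X}"
      using that(1) realized_well_formed by (auto simp: search_invariant_def)
    then have "length (R @ Y) \<le> ?n"
      using card_mono[OF finite_well_formed] distinct_card by metis
    then show ?thesis using that(2) by (cases Y) auto
  qed
  have step: "search_invariant (?c s) \<and> ?n - length (fst (?c s)) < ?n - length (fst s)"
    if "search_invariant s" "?b s" for s
  proof -
    obtain R Y Seen where s: "s = (R, Y, Seen, False)" "Y \<noteq> []" using \<open>?b s\<close> by (cases s) auto
    show ?thesis
      using search_invariant_step[of R Y Seen] bound[of R Y Seen False] \<open>search_invariant s\<close> s by auto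
  qed
  have "\<exists>t. while_option ?b ?c ?s = Some t"
    using measure_while_option_Some[of search_invariant ?b ?c "\<lambda>s. ?n - length (fst s)", OF step
        search_invariant_init] .
  then obtain t where t: "while_option ?b ?c ?s = Some t" by blast
  obtain R Y Seen ret where t_eq: "t = (R, Y, Seen, ret)" by (cases t) auto
  have "search_invariant t"
    by (rule while_option_rule[where P = search_invariant, OF _ t search_invariant_init]) (use step in blast)
  moreover have "ret \<or> Y = []" using while_option_stop[OF t] t_eq by simp
  moreover have "relabeled_inclusion_test D \<rho> r enum k = Some (if ret then Returned R else Inclusion_Holds)"
    using t unfolding relabeled_inclusion_test_def Let_def CAN_initial by (simp add: t_eq)
  ultimately show ?thesis using that t_eq by blast
qed

section \<open>Correctness of the outcome\<close>

lemma accepts_if_CAN_consistent: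
  assumes "legal k \<tau>" and "\<not> inconsistent D k (can (bag \<tau>, dyn D k \<tau>))"
  shows "accepts D k \<tau>"
proof -
  note wf = well_formed_term[OF assms(1)]
  obtain f where "f \<in> relabelings k" "can (bag \<tau>, dyn D k \<tau>) = relabel_state \<rho> k f (bag \<tau>, dyn D k \<tau>)"
    using relabeled_statesE[OF CAN_least(1)[OF wf]] by blast
  then show ?thesis
    using assms(2) act_set_final[OF _ well_formedD(4)[OF wf]]
    by (auto simp: inconsistent_def accepts_def relabel_state_def)
qed

lemma search_correct:
  "\<exists>res. relabeled_inclusion_test D \<rho> r enum k = Some res \<and>
    (res = Inclusion_Holds \<longleftrightarrow> (\<forall>\<tau>. legal k \<tau> \<longrightarrow> accepts D k \<tau>)) \<and>
    (\<not> (\<forall>\<tau>. legal k \<tau> \<longrightarrow> accepts D k \<tau>) \<longrightarrow>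
      (\<exists>R. res = Returned R \<and> canonized_refutation D Lbl \<rho> r k R))"
proof -
  obtain R Y Seen ret where
    res: "relabeled_inclusion_test D \<rho> r enum k = Some (if ret then Returned R else Inclusion_Holds)"
    and inv: "search_invariant (R, Y, Seen, ret)" and stop: "ret \<or> Y = []"
    by (rule search_terminates)
  have I: "Seen = set (R @ Y)" "\<forall>X\<in>Seen. realized X \<and> canonical \<rho> r k X"
    "R @ Y \<noteq> []" "hd (R @ Y) = initial_state D k" "derivation (R @ Y)"
    using inv by (simp_all add: search_invariant_def)
  show ?thesis
  proof (cases ret)
    case True
    have R: "R \<noteq> []" "inconsistent D k (last R)" using inv True by (simp_all add: search_invariant_def)
    \<comment> \<open>Realizability turns inconsistency of a state into rejection of a term.\<close>
    have "realized (last R)" using R(1) I(1,2) by simp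
    then obtain \<tau> where \<tau>: "legal k \<tau>" "last R = (bag \<tau>, dyn D k \<tau>)" unfolding realized_def by blast
    have "\<not> accepts D k \<tau>" using R(2) unfolding \<tau>(2) inconsistent_def accepts_def by simp
    \<comment> \<open>The invariant justifies \<open>R @ Y\<close>; cutting off the pending queue
      keeps the justification of \<open>R\<close>.\<close>
    moreover have "canonized_refutation D Lbl \<rho> r k R"
      unfolding canonized_refutation_def derivation_def[symmetric]
      using R I(1,2,4) derivation_append_left[OF I(5)] realized_well_formed by simp
    ultimately show ?thesis using res True \<tau>(1) by auto
  next
    case False
    then have "Y = []" using stop by simp
    \<comment> \<open>With an empty queue \<open>Seen\<close> equals \<open>set R\<close>, so
      closure up to pending states becomes closure of \<open>R\<close> itself.\<close>
    have C: "\<forall>X\<in>set R. \<not> inconsistent D k X" "can ` derived (set R) \<subseteq> set R"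
      using inv False \<open>Y = []\<close> I(1) unfolding search_invariant_def by simp_all
    have "initial_state D k \<in> set R" using I(3,4) \<open>Y = []\<close> by (metis append_Nil2 hd_in_set)
    then have "accepts D k \<tau>" if "legal k \<tau>" for \<tau>
      using accepts_if_CAN_consistent[OF that] closed_contains_terms[OF _ C(2) that] C(1) by blast
    then show ?thesis using res False by auto
  qed
qed

end

theorem theorem4:
  fixes k :: nat and D :: dpcore and Lbl :: labelling and \<rho> :: action
    and r :: "witness rel" and enum :: "state list \<Rightarrow> state set \<Rightarrow> state list"
  assumes "is_dpcore D" and "finite_core D" and "coherent D"
    and "is_labelling D Lbl" and "interface_respecting D Lbl"
    and "identity_cleaning D"
    and "witness_action D Lbl \<rho>"
    and "linear_order_on (wits D k) r"
    and "\<And>R X. finite X \<Longrightarrow> set (enum R X) = X"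
  shows "\<exists>res. relabeled_inclusion_test D \<rho> r enum k = Some res \<and>
      (res = Inclusion_Holds \<longleftrightarrow> (\<forall>G. treewidth_le k G \<longrightarrow> G \<in> graph_property D)) \<and>
      (\<not> (\<forall>G. treewidth_le k G \<longrightarrow> G \<in> graph_property D) \<longrightarrow>
         (\<exists>R. res = Returned R \<and> canonized_refutation D Lbl \<rho> r k R))"
proof -
  interpret relabeled_test D Lbl \<rho> k r enum
    using assms by unfold_locales (simp_all add: finite_core_def)
  show ?thesis
    unfolding treewidth_subset_iff_accepts[OF assms(3)] by (rule search_correct)
qed

end
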